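(* Let $A$ be a unital $C^\star$-algebra, let $B$ be a unital complex Banach algebra, and let $\phi:A\to B$ be a surjective map (not assumed linear or multiplicative). Then $\phi$ is an isomorphism from $A$ onto $B$ if and only if $\phi$ satisfies both of the following properties: (i) $\sigma\left(\prod_{i=1}^m\phi(x_i)\right)=\sigma\left(\prod_{i=1}^m x_i\right)$ for all $m\in\{1,2,3\}$ and all $x_1,\dots,x_m\in A$; (ii) $\phi$ is continuous at $\mathbf 1$.
   Context: All Banach algebras (including $C^\star$-algebras) are complex and unital (and nonzero), with unit denoted $\mathbf 1$. For an element $x$ of a Banach algebra with group of invertible elements $G$, the spectrum is $\sigma(x)=\{\lambda\in\mathbb C:\lambda\mathbf 1-x\notin G\}$; the spectrum on the left-hand side of (i) is taken in $B$ and the one on the right-hand side in $A$. "Isomorphism" means an isomorphism of complex algebras, i.e. a linear multiplicative bijection. Continuity is with respect to the norm topologies of $A$ and $B$. *)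

theory Defs
  imports "HOL-Analysis.Analysis"
begin

(* The library's normed algebras are real, so the complex scalar multiplication is an extra
   operation that restricts to the real one.  No normalisation of the norm of the unit is assumed;
   the unit is nonzero because real_algebra_1 extends ring_1. *)
class complex_banach_algebra = real_algebra_1 + real_normed_algebra + banach +
  fixes scaleC :: "complex \<Rightarrow> 'a \<Rightarrow> 'a"  (infixr "*\<^sub>C" 75)
  assumes scaleR_scaleC: "r *\<^sub>R x = complex_of_real r *\<^sub>C x"
    and scaleC_add_right: "a *\<^sub>C (x + y) = a *\<^sub>C x + a *\<^sub>C y"
    and scaleC_add_left: "(a + b) *\<^sub>C x = a *\<^sub>C x + b *\<^sub>C x"
    and scaleC_scaleC: "a *\<^sub>C (b *\<^sub>C x) = (a * b) *\<^sub>C x"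
    and mult_scaleC_left: "(a *\<^sub>C x) * y = a *\<^sub>C (x * y)"
    and mult_scaleC_right: "x * (a *\<^sub>C y) = a *\<^sub>C (x * y)"
    and norm_scaleC: "norm (a *\<^sub>C x) = cmod a * norm x"

lemma vector_space_scaleC:
  "vector_space (scaleC :: complex \<Rightarrow> 'a \<Rightarrow> 'a::complex_banach_algebra)"
proof
  show "1 *\<^sub>C x = x" for x :: 'a
    using scaleR_scaleC[of 1 x] by simp
qed (simp_all add: scaleC_add_right scaleC_add_left scaleC_scaleC)

class cstar_algebra = complex_banach_algebra +
  fixes cstar :: "'a \<Rightarrow> 'a"
  assumes cstar_add: "cstar (x + y) = cstar x + cstar y"
    and cstar_scaleC: "cstar (a *\<^sub>C x) = cnj a *\<^sub>C cstar x"
    and cstar_mult: "cstar (x * y) = cstar y * cstar x"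
    and cstar_cstar: "cstar (cstar x) = x"
    and norm_cstar_mult: "norm (cstar x * x) = (norm x)\<^sup>2"

instance cstar_algebra \<subseteq> real_normed_algebra_1
proof
  have "cstar (1::'a) = 1"
    by (metis cstar_cstar cstar_mult mult_1_left mult_1_right)
  then have "norm (1::'a) = (norm (1::'a))\<^sup>2"
    using norm_cstar_mult[of "1::'a"] by simp
  then show "norm (1::'a) = 1"
    by (simp add: power2_eq_square)
qed

definition invertibles :: "'a::monoid_mult set" where
  "invertibles = {x. \<exists>y. x * y = 1 \<and> y * x = 1}"

definition spectrum :: "'a::complex_banach_algebra \<Rightarrow> complex set" where
  "spectrum x = {l. l *\<^sub>C 1 - x \<notin> invertibles}"

definition algebra_isomorphism ::
    "('a::complex_banach_algebra \<Rightarrow> 'b::complex_banach_algebra) \<Rightarrow> bool" where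
  "algebra_isomorphism \<phi> \<longleftrightarrow>
     Vector_Spaces.linear scaleC scaleC \<phi> \<and> (\<forall>x y. \<phi> (x * y) = \<phi> x * \<phi> y) \<and> bij \<phi>"

end

theory Submission
  imports Defs "HOL-Computational_Algebra.Fundamental_Theorem_Algebra"
begin

text \<open>
  Let \<open>\<sigma>\<close> denote the spectrum, let \<open>A\<close> be the C*-algebra and \<open>B\<close> the Banach algebra.

  The spectra of all products with \<open>a\<close> determine an element \<open>a\<close> of a C*-algebra
  (\<open>element_determined_by_spectra\<close>).  Since \<open>\<phi>\<close> is onto, \<open>\<phi> x \<phi> y = \<phi> t\<close> for some \<open>t\<close>, and comparing
  \<open>\<sigma> (t z) = \<sigma> (\<phi> t \<phi> z)\<close> with \<open>\<sigma> (x y z) = \<sigma> (\<phi> x \<phi> y \<phi> z)\<close> gives \<open>t = x y\<close>.  In the same way \<open>\<phi>\<close> is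
  injective and homogeneous.  What remains is additivity, for which every defect of additivity is
  itself written as \<open>\<phi> y\<close>, and \<open>y\<close> is shown to vanish.

  For self-adjoint \<open>h\<close> consider the defect \<open>\<phi> y = \<phi> (1 + z h) - 1 - z \<phi> h\<close> (\<open>phi_one_plus\<close>).  If \<open>g\<close> is a
  bump function around \<open>c\<close>, then \<open>h g (h) = k (h) g (h)\<close> for a function \<open>k\<close> close to the constant \<open>c\<close>, so in
  \<open>\<phi> y \<phi> (g (h))\<close> one may replace \<open>h\<close> by \<open>k (h)\<close>.  As \<open>\<phi>\<close> preserves spectra, \<open>\<phi> (1 + z k (h))\<close> and
  \<open>z \<phi> (k (h))\<close> differ from the scalars \<open>1 + z c\<close> and \<open>z c\<close> by commuting elements of small spectral radius.
  Hence \<open>g (h) y y\<^sup>*\<close> has small spectral radius, which for this self-adjoint element is the norm.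
  Bumps with disjoint supports give orthogonal elements, for which the norm of a sum is the maximum of
  the norms; two such families form a partition of unity, so \<open>y y\<^sup>* = 0\<close>.

  Multiplicativity spreads this: \<open>p\<^sup>2 + z b = p (1 + z p\<^sup>-\<^sup>1 b p\<^sup>-\<^sup>1) p\<close>, so \<open>\<phi> (a + z b) = \<phi> a + z \<phi> b\<close> when
  \<open>a = p\<^sup>2\<close> is positive and invertible and \<open>b\<close> is self-adjoint.  Therefore
  \<open>\<Phi> x = \<phi> (Re x) + i \<phi> (Im x)\<close> is linear, and it agrees with \<open>\<phi>\<close> on elements with positive invertible real
  part.  For arbitrary \<open>x\<close> with real part \<open>a\<close>, the element \<open>x + (k - a)\<^sub>+\<close> is of that kind and has the same
  product with \<open>(a - k)\<^sub>+\<close> as \<open>x\<close>, where \<open>k > 0\<close>.  Thus the defect \<open>\<phi> y = \<phi> x - \<Phi> x\<close> satisfies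
  \<open>y (a - k)\<^sub>+ = 0\<close>, and by symmetry \<open>y\<close> annihilates the real and the imaginary part of \<open>x\<close>, which forces
  \<open>y y\<^sup>* = 0\<close> (\<open>phi_eq_linear_ext\<close>).

  Conversely, an isomorphism preserves spectra, so the C*-norm satisfies
  \<open>norm x\<^sup>2 = norm (x\<^sup>* x) \<le> norm (\<phi> x\<^sup>*) norm (\<phi> x)\<close>.  Two applications of the closed graph theorem, to the
  involution transported to \<open>B\<close> and then to \<open>\<phi>\<close>, show that it is continuous.

  Two tools are developed on the way: the spectral radius formula, in the form of a growth estimate for
  powers, and the continuous functional calculus of a self-adjoint element.
\<close>

section \<open>Invertible elements and spectra\<close>

interpretation complex_scale:
  vector_space "scaleC :: complex \<Rightarrow> 'a \<Rightarrow> 'a::complex_banach_algebra"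
  by (rule vector_space_scaleC)

lemma scaleC_1_mult [simp]: "(a *\<^sub>C 1) * x = a *\<^sub>C x" "x * (a *\<^sub>C 1) = a *\<^sub>C x"
  by (simp_all add: mult_scaleC_left mult_scaleC_right)

lemmas scaleC_algebra = complex_scale.scale_right_distrib complex_scale.scale_right_diff_distrib
  complex_scale.scale_left_distrib complex_scale.scale_left_diff_distrib
  mult_scaleC_left mult_scaleC_right

lemma invertiblesI: "x * y = 1 \<Longrightarrow> y * x = 1 \<Longrightarrow> x \<in> invertibles"
  by (auto simp: invertibles_def)

lemma invertiblesE:
  assumes "x \<in> invertibles"
  obtains y where "x * y = 1" "y * x = 1"
  using assms by (auto simp: invertibles_def)

lemma one_invertible [simp]: "1 \<in> invertibles"
  by (rule invertiblesI[of _ 1]) auto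

lemma zero_not_invertible [simp]: "(0 :: 'a::ring_1) \<notin> invertibles"
  by (auto simp: invertibles_def)

lemma invertible_mult:
  assumes "x \<in> invertibles" "y \<in> invertibles" shows "x * y \<in> invertibles"
proof -
  obtain x' y' where "x * x' = 1" "x' * x = 1" "y * y' = 1" "y' * y = 1"
    using assms by (metis invertiblesE)
  then have "(x * y) * (y' * x') = 1" "(y' * x') * (x * y) = 1"
    by (metis mult.assoc mult_1_right)+
  then show ?thesis by (rule invertiblesI)
qed

lemma invertible_mult_left_iff:
  assumes "x \<in> invertibles" shows "x * y \<in> invertibles \<longleftrightarrow> y \<in> invertibles"
proof
  obtain x' where x': "x * x' = 1" "x' * x = 1" using assms by (rule invertiblesE)
  then have "x' \<in> invertibles" by (auto intro: invertiblesI)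
  moreover assume "x * y \<in> invertibles"
  ultimately have "x' * (x * y) \<in> invertibles" by (rule invertible_mult)
  then show "y \<in> invertibles" by (simp add: mult.assoc[symmetric] x')
qed (simp add: invertible_mult assms)

lemma invertible_mult_right_iff:
  assumes "y \<in> invertibles" shows "x * y \<in> invertibles \<longleftrightarrow> x \<in> invertibles"
proof
  obtain y' where y': "y * y' = 1" "y' * y = 1" using assms by (rule invertiblesE)
  then have "y' \<in> invertibles" by (auto intro: invertiblesI)
  moreover assume "x * y \<in> invertibles"
  ultimately have "x * y * y' \<in> invertibles" by (metis invertible_mult)
  then show "x \<in> invertibles" by (simp add: mult.assoc y')
qed (simp add: invertible_mult assms)

lemma invertible_commuting_factor:
  assumes "x * y \<in> invertibles" "x * y = y * x" shows "x \<in> invertibles"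
proof -
  obtain z where z: "x * y * z = 1" "z * (x * y) = 1" using assms(1) by (rule invertiblesE)
  have l: "(z * y) * x = 1" using z(2) assms(2) by (simp add: mult.assoc)
  have r: "x * (y * z) = 1" using z(1) by (simp add: mult.assoc)
  have "z * y = y * z" by (metis l r mult.assoc mult_1_left mult_1_right)
  with l r show ?thesis by (intro invertiblesI[of x "y * z"]) auto
qed

lemma invertible_scaleC_iff:
  fixes x :: "'a::complex_banach_algebra"
  assumes "c \<noteq> 0" shows "c *\<^sub>C x \<in> invertibles \<longleftrightarrow> x \<in> invertibles"
proof -
  have "c *\<^sub>C (1::'a) \<in> invertibles"
    using assms by (intro invertiblesI[of _ "inverse c *\<^sub>C 1"]) (auto simp: scaleC_scaleC)
  from invertible_mult_left_iff[OF this, of x] show ?thesis by simp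
qed

lemma invertible_minus_iff:
  fixes x :: "'a::complex_banach_algebra"
  shows "- x \<in> invertibles \<longleftrightarrow> x \<in> invertibles"
  using invertible_scaleC_iff[of "-1" x] by simp

lemma left_right_inverse_eq:
  fixes x :: "'a::monoid_mult"
  assumes "y * x = 1" "x * z = 1" shows "y = z"
  by (metis assms mult.assoc mult_1_left mult_1_right)

lemma not_in_spectrum_iff: "l \<notin> spectrum x \<longleftrightarrow> l *\<^sub>C 1 - x \<in> invertibles"
  by (simp add: spectrum_def)

lemma spectrum_shift: "l \<in> spectrum (x + c *\<^sub>C 1) \<longleftrightarrow> l - c \<in> spectrum x"
  by (simp add: spectrum_def scaleC_algebra algebra_simps)

lemma spectrum_scale:
  assumes "c \<noteq> 0" shows "l \<in> spectrum (c *\<^sub>C x) \<longleftrightarrow> l / c \<in> spectrum x"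
proof -
  have "l *\<^sub>C 1 - c *\<^sub>C x = c *\<^sub>C ((l / c) *\<^sub>C 1 - x)"
    using assms by (simp add: scaleC_algebra scaleC_scaleC)
  then show ?thesis using assms by (simp add: spectrum_def invertible_scaleC_iff)
qed

lemma spectrum_uminus: "l \<in> spectrum (- x) \<longleftrightarrow> - l \<in> spectrum x"
  using spectrum_scale[of "-1" l x] by simp

lemma spectrum_zero [simp]: "spectrum (0 :: 'a::complex_banach_algebra) = {0}"
  using invertible_scaleC_iff[where x = "1::'a"] by (auto simp: spectrum_def)

text \<open>If \<open>u\<close> inverts \<open>1 - x y\<close>, then \<open>1 + y u x\<close> inverts \<open>1 - y x\<close>: formally, this is what summing
  the geometric series \<open>\<Sum> (y x)\<^sup>n = 1 + y (\<Sum> (x y)\<^sup>n) x\<close> gives.\<close>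

lemma invertible_one_minus_swap:
  fixes x y :: "'a::ring_1"
  assumes "1 - x * y \<in> invertibles" shows "1 - y * x \<in> invertibles"
proof -
  obtain u where u: "(1 - x * y) * u = 1" "u * (1 - x * y) = 1"
    using assms by (rule invertiblesE)
  have 1: "x * (y * u) = u - 1" "u * (x * y) = u - 1" using u by (simp_all add: algebra_simps)
  have "(1 - y * x) * (1 + y * u * x) = 1 - y * x + y * u * x - y * (x * (y * u)) * x"
    by (simp add: algebra_simps)
  also have "\<dots> = 1" unfolding 1 by (simp add: algebra_simps)
  finally have a: "(1 - y * x) * (1 + y * u * x) = 1" .
  have "(1 + y * u * x) * (1 - y * x) = 1 - y * x + y * u * x - y * (u * (x * y)) * x"
    by (simp add: algebra_simps)
  also have "\<dots> = 1" unfolding 1 by (simp add: algebra_simps)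
  finally show ?thesis using a by (auto intro: invertiblesI)
qed

lemma nonzero_spectrum_swap:
  assumes "l \<noteq> 0" shows "l \<in> spectrum (x * y) \<longleftrightarrow> l \<in> spectrum (y * x)"
proof -
  have *: "l \<notin> spectrum (x * y) \<longleftrightarrow> 1 - ((1/l) *\<^sub>C x) * y \<in> invertibles" for x y :: 'a
  proof -
    have "l *\<^sub>C 1 - x * y = l *\<^sub>C (1 - ((1/l) *\<^sub>C x) * y)"
      using assms by (simp add: scaleC_algebra scaleC_scaleC)
    then show ?thesis using assms by (simp add: not_in_spectrum_iff invertible_scaleC_iff)
  qed
  show ?thesis using *[of x y] *[of y x]
      invertible_one_minus_swap[of "(1/l) *\<^sub>C x" y] invertible_one_minus_swap[of y "(1/l) *\<^sub>C x"]
      invertible_one_minus_swap[of "(1/l) *\<^sub>C y" x] invertible_one_minus_swap[of x "(1/l) *\<^sub>C y"]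
    by (auto simp: scaleC_algebra)
qed

text \<open>For orthogonal \<open>x\<close> and \<open>y\<close>, the product \<open>(l - x) (l - y)\<close> is \<open>l (l - (x + y))\<close>.\<close>

lemma spectrum_orthogonal_sum:
  fixes x y :: "'a::complex_banach_algebra"
  assumes "x * y = 0" "y * x = 0" "l \<noteq> 0"
  shows "l \<in> spectrum (x + y) \<longleftrightarrow> l \<in> spectrum x \<or> l \<in> spectrum y"
proof -
  let ?a = "l *\<^sub>C 1 - x" and ?b = "l *\<^sub>C 1 - y"
  have ab: "?a * ?b = l *\<^sub>C (l *\<^sub>C 1 - (x + y))" and ba: "?b * ?a = l *\<^sub>C (l *\<^sub>C 1 - (x + y))"
    using assms by (simp_all add: algebra_simps scaleC_algebra)
  have "l \<notin> spectrum (x + y) \<longleftrightarrow> ?a * ?b \<in> invertibles"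
    unfolding ab not_in_spectrum_iff using assms(3) by (simp add: invertible_scaleC_iff)
  also have "\<dots> \<longleftrightarrow> ?a \<in> invertibles \<and> ?b \<in> invertibles"
    using ab ba by (metis invertible_commuting_factor invertible_mult)
  finally show ?thesis by (auto simp: spectrum_def)
qed

lemma spectrum_orthogonal_family:
  fixes x :: "'i \<Rightarrow> 'a::complex_banach_algebra"
  assumes "finite I" "\<And>i. i \<in> I \<Longrightarrow> spectrum (x i) \<subseteq> cball 0 r" "0 \<le> r"
    and "\<And>i j. i \<in> I \<Longrightarrow> j \<in> I \<Longrightarrow> i \<noteq> j \<Longrightarrow> x i * x j = 0"
  shows "spectrum (\<Sum>i\<in>I. x i) \<subseteq> cball 0 r"
  using assms
proof (induction I rule: finite_induct)
  case (insert i I)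
  have "x i * (\<Sum>j\<in>I. x j) = 0" "(\<Sum>j\<in>I. x j) * x i = 0"
  proof -
    have "x i * x j = 0" "x j * x i = 0" if "j \<in> I" for j
      using insert.hyps(2) that by (intro insert.prems(3); auto)+
    then show "x i * (\<Sum>j\<in>I. x j) = 0" "(\<Sum>j\<in>I. x j) * x i = 0"
      by (simp_all add: sum_distrib_left sum_distrib_right)
  qed
  moreover have "spectrum (\<Sum>j\<in>I. x j) \<subseteq> cball 0 r" "spectrum (x i) \<subseteq> cball 0 r"
    using insert by auto
  ultimately have "l \<in> cball 0 r" if "l \<in> spectrum (x i + (\<Sum>j\<in>I. x j))" for l
    using that spectrum_orthogonal_sum[of "x i" "\<Sum>j\<in>I. x j" l] insert.prems(2)
    by (cases "l = 0") auto
  then show ?case using insert by auto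
qed simp

section \<open>The spectral radius formula\<close>

lemma Neumann_series:
  fixes x :: "'a::complex_banach_algebra"
  assumes "summable (\<lambda>n. norm (x ^ n))"
  shows "(1 - x) * (\<Sum>n. x ^ n) = 1" "(\<Sum>n. x ^ n) * (1 - x) = 1"
proof -
  have s: "summable (\<lambda>n. x ^ n)" using assms by (rule summable_norm_cancel)
  have split: "(\<Sum>n. x ^ n) = 1 + (\<Sum>n. x ^ Suc n)"
    using suminf_split_head[OF s] by simp
  have "(\<Sum>n. x ^ Suc n) = x * (\<Sum>n. x ^ n)"
    using suminf_mult[OF s, of x] by (simp add: power_Suc)
  with split show "(1 - x) * (\<Sum>n. x ^ n) = 1" by (simp add: algebra_simps)
  have "(\<Sum>n. x ^ Suc n) = (\<Sum>n. x ^ n) * x"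
    using suminf_mult2[OF s, of x] by (simp add: power_Suc2 del: power_Suc)
  with split show "(\<Sum>n. x ^ n) * (1 - x) = 1" by (simp add: algebra_simps)
qed

lemma norm_power_Suc_le: "norm (x ^ Suc n) \<le> norm (x::'a::complex_banach_algebra) ^ Suc n"
proof (induction n)
  case (Suc n)
  have "norm (x ^ Suc (Suc n)) \<le> norm x * norm (x ^ Suc n)"
    using norm_mult_ineq[of x "x ^ Suc n"] by simp
  also have "\<dots> \<le> norm x * norm x ^ Suc n" by (rule mult_left_mono[OF Suc]) simp
  finally show ?case by simp
qed simp

text \<open>The Neumann series is estimated from its linear term on, because the unit of a
  Banach algebra may have any norm.\<close>

lemma near_one_inverse:
  fixes x :: "'a::complex_banach_algebra"
  assumes "norm x < 1"
  obtains y where "(1 - x) * y = 1" "y * (1 - x) = 1" "norm (y - 1) \<le> norm x / (1 - norm x)"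
proof -
  have "(\<lambda>n. norm x ^ n) sums (1 / (1 - norm x))" using assms by (intro geometric_sums) simp
  from sums_mult[OF this, of "norm x"] have g: "(\<lambda>n. norm x ^ Suc n) sums (norm x / (1 - norm x))"
    by simp
  have sn: "summable (\<lambda>n. norm (x ^ Suc n))"
    by (rule summable_comparison_test'[of "\<lambda>n. norm x ^ Suc n" 0])
      (use sums_summable[OF g] norm_power_Suc_le[of x] in auto)
  then have s: "summable (\<lambda>n. norm (x ^ n))" using summable_Suc_iff[of "\<lambda>n. norm (x ^ n)"] by blast
  have "(\<Sum>n. x ^ n) - 1 = (\<Sum>n. x ^ Suc n)"
    using suminf_split_head[OF summable_norm_cancel[OF s]] by simp
  also have "norm \<dots> \<le> (\<Sum>n. norm (x ^ Suc n))" by (rule summable_norm[OF sn])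
  also have "\<dots> \<le> (\<Sum>n. norm x ^ Suc n)"
    by (rule suminf_le[OF norm_power_Suc_le sn sums_summable[OF g]])
  also have "\<dots> = norm x / (1 - norm x)" using g by (rule sums_unique[symmetric])
  finally show ?thesis using that Neumann_series[OF s] by blast
qed

text \<open>Spectral radii are bounded here through the growth of powers, as such bounds multiply
  and add for commuting elements.\<close>

lemma spectrum_power_bound:
  fixes x :: "'a::complex_banach_algebra"
  assumes "\<And>n. norm (x ^ n) \<le> C * r ^ n" "0 \<le> r"
  shows "spectrum x \<subseteq> cball 0 r"
proof
  fix l assume l: "l \<in> spectrum x"
  show "l \<in> cball 0 r"
  proof (rule ccontr)
    assume "l \<notin> cball 0 r"
    then have r: "r < cmod l" by simp
    then have l0: "l \<noteq> 0" using assms(2) by auto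
    have pow: "((1/l) *\<^sub>C x) ^ n = (1/l) ^ n *\<^sub>C x ^ n" for n
      by (induction n) (simp_all add: scaleC_algebra scaleC_scaleC)
    have bound: "norm (((1/l) *\<^sub>C x) ^ n) \<le> C * (r / cmod l) ^ n" for n
    proof -
      have "norm (((1/l) *\<^sub>C x) ^ n) = norm (x ^ n) / cmod l ^ n"
        by (simp add: pow norm_scaleC norm_power norm_divide power_divide)
      also have "\<dots> \<le> C * r ^ n / cmod l ^ n" by (intro divide_right_mono assms) simp
      finally show ?thesis by (simp add: power_divide)
    qed
    have "summable (\<lambda>n. norm (((1/l) *\<^sub>C x) ^ n))"
    proof (rule summable_comparison_test')
      have "r / cmod l < 1" using r assms(2) by (simp add: divide_less_eq)
      then show "summable (\<lambda>n. C * (r / cmod l) ^ n)"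
        using assms(2) by (intro summable_mult summable_geometric) simp
      show "norm (norm (((1/l) *\<^sub>C x) ^ n)) \<le> C * (r / cmod l) ^ n" if "0 \<le> n" for n
        using bound[of n] by simp
    qed
    from Neumann_series[OF this] have "1 - (1/l) *\<^sub>C x \<in> invertibles" by (rule invertiblesI)
    moreover have "l *\<^sub>C 1 - x = l *\<^sub>C (1 - (1/l) *\<^sub>C x)"
      using l0 by (simp add: scaleC_algebra scaleC_scaleC)
    ultimately show False using l l0 by (simp add: spectrum_def invertible_scaleC_iff)
  qed
qed

lemma spectrum_norm_bound: "spectrum (x::'a::complex_banach_algebra) \<subseteq> cball 0 (norm x)"
proof (rule spectrum_power_bound)
  show "norm (x ^ n) \<le> max 1 (norm (1::'a)) * norm x ^ n" for n
  proof (cases n)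
    case (Suc m)
    have "1 * norm x ^ n \<le> max 1 (norm (1::'a)) * norm x ^ n"
      by (intro mult_right_mono) auto
    then show ?thesis using norm_power_Suc_le[of x m] Suc by simp
  qed simp
qed simp

lemma one_minus_power_factor:
  fixes x :: "'a::ring_1"
  shows "1 - x ^ n = (\<Sum>j<n. x ^ j) * (1 - x)"
  by (induction n) (simp_all add: algebra_simps power_commutes)

lemma scaleC_power: "(c *\<^sub>C x) ^ n = c ^ n *\<^sub>C x ^ n"
  by (induction n) (simp_all add: scaleC_algebra scaleC_scaleC)

lemma cis_root_of_unity_power:
  "n > 0 \<Longrightarrow> cis (2 * pi * real k / real n) ^ n = 1"
  by (subst Complex.DeMoivre) (use cis_multiple_2pi[of "real k"] in \<open>simp add: mult_ac\<close>)

text \<open>Since \<open>w\<^sub>k ^ j = w\<^sub>j ^ k\<close> for \<open>w\<^sub>k = cis (2 * pi * k / n)\<close>, this is a geometric sum.\<close>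

lemma sum_powers_root_of_unity:
  fixes n j :: nat
  assumes "j < n" "n > 0"
  shows "(\<Sum>k<n. cis (2 * pi * real k / real n) ^ j) = (if j = 0 then of_nat n else 0)"
proof (cases "j = 0")
  case False
  let ?w = "cis (2 * pi * real j / real n)"
  have swap: "cis (2 * pi * real k / real n) ^ j = ?w ^ k" for k
    by (simp add: Complex.DeMoivre mult_ac)
  have w1: "?w \<noteq> 1"
  proof
    assume "?w = 1"
    then have eq: "cis (2 * pi * real j / real n) = cis (2 * pi * real 0 / real n)" by simp
    have "inj_on (\<lambda>k. cis (2 * pi * real k / real n)) {..<n}"
      using Complex.bij_betw_roots_unity[OF assms(2)] by (simp add: bij_betw_def)
    from inj_onD[OF this eq] have "j = 0" using assms by simp
    then show False using False by simp
  qed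
  have "?w ^ n = 1" using assms by (intro cis_root_of_unity_power) simp
  then have "(\<Sum>k<n. ?w ^ k) = 0" using w1 geometric_sum[OF w1, of n] by simp
  then show ?thesis using False by (simp add: swap)
qed simp

text \<open>The resolvent of \<open>x ^ n\<close> is the average of the resolvent of \<open>x\<close> over the \<open>n\<close>-th roots of
  unity.  This replaces Cauchy's formula in the proof of the spectral radius formula.\<close>

lemma resolvent_average:
  fixes x :: "'a::complex_banach_algebra"
  assumes "n > 0"
    and R: "\<And>k. k < n \<Longrightarrow> (1 - (c * cis (2 * pi * real k / real n)) *\<^sub>C x) * R k = 1"
  shows "(1 - (c *\<^sub>C x) ^ n) * (\<Sum>k<n. R k) = real n *\<^sub>R 1"
proof -
  let ?w = "\<lambda>k. cis (2 * pi * real k / real n)"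
  have "(1 - (c *\<^sub>C x) ^ n) * R k = (\<Sum>j<n. (?w k) ^ j *\<^sub>C (c *\<^sub>C x) ^ j)" if "k < n" for k
  proof -
    let ?u = "(c * ?w k) *\<^sub>C x"
    have "?w k ^ n = 1" using assms(1) by (rule cis_root_of_unity_power)
    then have un: "?u ^ n = (c *\<^sub>C x) ^ n" by (simp add: scaleC_power power_mult_distrib)
    have "1 - ?u ^ n = (\<Sum>j<n. ?u ^ j) * (1 - ?u)"
      by (rule one_minus_power_factor)
    then have sum: "(1 - ?u ^ n) * R k = (\<Sum>j<n. ?u ^ j)" using R[OF that] by (simp add: mult.assoc)
    have "?u ^ j = (?w k) ^ j *\<^sub>C (c *\<^sub>C x) ^ j" for j
      by (simp add: scaleC_power power_mult_distrib scaleC_scaleC mult.commute)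
    with sum[unfolded un] show ?thesis by simp
  qed
  then have "(1 - (c *\<^sub>C x) ^ n) * (\<Sum>k<n. R k) = (\<Sum>k<n. \<Sum>j<n. (?w k) ^ j *\<^sub>C (c *\<^sub>C x) ^ j)"
    by (simp add: sum_distrib_left)
  also have "\<dots> = (\<Sum>j<n. (\<Sum>k<n. (?w k) ^ j) *\<^sub>C (c *\<^sub>C x) ^ j)"
    by (subst sum.swap) (simp add: complex_scale.scale_sum_left)
  also have "\<dots> = (\<Sum>j<n. (if j = 0 then of_nat n else 0) *\<^sub>C (c *\<^sub>C x) ^ j)"
    by (intro sum.cong refl arg_cong2[where f = scaleC] sum_powers_root_of_unity) (use assms(1) in auto)
  also have "\<dots> = (\<Sum>j<n. if j = 0 then of_nat n *\<^sub>C (c *\<^sub>C x) ^ j else 0)"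
    by (intro sum.cong) auto
  also have "\<dots> = of_nat n *\<^sub>C 1" using assms(1) by (simp add: sum.delta)
  finally show ?thesis by (simp add: scaleR_scaleC)
qed

text \<open>Near \<open>m\<^sub>0\<close> the factorization \<open>1 - m x = (1 - m\<^sub>0 x) (1 - u)\<close> with
  \<open>u = (m - m\<^sub>0) (1 - m\<^sub>0 x)\<^sup>-\<^sup>1 x\<close> reduces continuity of the resolvent to inverses near \<open>1\<close>;
  compactness of the disc makes it uniform.\<close>

lemma uniform_resolvent:
  fixes x :: "'a::complex_banach_algebra"
  assumes inv: "\<And>m. m \<in> cball 0 s0 \<Longrightarrow> 1 - m *\<^sub>C x \<in> invertibles"
  obtains R where "\<And>m. m \<in> cball 0 s0 \<Longrightarrow> (1 - m *\<^sub>C x) * R m = 1"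
    and "uniformly_continuous_on (cball 0 s0) R"
proof -
  have "\<forall>m. \<exists>y. m \<in> cball 0 s0 \<longrightarrow> (1 - m *\<^sub>C x) * y = 1 \<and> y * (1 - m *\<^sub>C x) = 1"
    using inv by (metis invertiblesE)
  then obtain R where R: "\<And>m. m \<in> cball 0 s0 \<Longrightarrow> (1 - m *\<^sub>C x) * R m = 1"
      "\<And>m. m \<in> cball 0 s0 \<Longrightarrow> R m * (1 - m *\<^sub>C x) = 1"
    by metis
  have "continuous_on (cball 0 s0) R"
    unfolding continuous_on_iff
  proof (intro ballI allI impI)
    fix m0 :: complex and e :: real assume m0: "m0 \<in> cball 0 s0" and e: "0 < e"
    define K where "K = norm (R m0 * x) + 1"
    define L where "L = norm (R m0) + 1"
    have K: "K > 0" and L: "L > 0" by (auto simp: K_def L_def add_nonneg_pos)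
    define d where "d = min (1 / (2 * K)) (e / (4 * K * L))"
    have "d > 0" using K L e by (simp add: d_def)
    moreover have "dist (R m) (R m0) < e" if m: "m \<in> cball 0 s0" "dist m m0 < d" for m
    proof -
      define u where "u = (m - m0) *\<^sub>C (R m0 * x)"
      have nu: "norm u \<le> cmod (m - m0) * K"
        by (simp add: u_def norm_scaleC K_def mult_left_mono)
      have cm: "cmod (m - m0) < d" using m by (simp add: dist_norm)
      have "cmod (m - m0) * K \<le> d * K" using cm K by (intro mult_right_mono) auto
      also have "\<dots> \<le> 1 / (2 * K) * K" using K by (intro mult_right_mono) (auto simp: d_def)
      also have "\<dots> = 1/2" using K by simp
      finally have u2: "norm u \<le> 1/2" using nu by simp
      then obtain y where y: "(1 - u) * y = 1" "y * (1 - u) = 1"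
          "norm (y - 1) \<le> norm u / (1 - norm u)"
        using near_one_inverse[of u] by auto
      have fac: "1 - m *\<^sub>C x = (1 - m0 *\<^sub>C x) * (1 - u)"
      proof -
        have "(1 - m0 *\<^sub>C x) * (R m0 * x) = x"
          unfolding mult.assoc[symmetric] R(1)[OF m0] by simp
        then have "(1 - m0 *\<^sub>C x) * u = m *\<^sub>C x - m0 *\<^sub>C x"
          unfolding u_def mult_scaleC_right by (simp add: complex_scale.scale_left_diff_distrib)
        then show ?thesis by (simp add: right_diff_distrib)
      qed
      have "R m = y * R m0"
      proof -
        have "(1 - m *\<^sub>C x) * (y * R m0) = (1 - m0 *\<^sub>C x) * ((1 - u) * y) * R m0"
          by (simp only: fac mult.assoc)
        also have "\<dots> = 1" using y(1) R(1)[OF m0] by simp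
        finally show ?thesis using R(2)[OF m(1)] left_right_inverse_eq by metis
      qed
      then have "R m - R m0 = (y - 1) * R m0" by (simp add: algebra_simps)
      then have "norm (R m - R m0) \<le> norm (y - 1) * norm (R m0)" by (simp add: norm_mult_ineq)
      also have "\<dots> \<le> (2 * norm u) * L"
      proof (intro mult_mono)
        have "norm u / (1 - norm u) \<le> norm u / (1/2)" using u2 by (intro divide_left_mono) auto
        then show "norm (y - 1) \<le> 2 * norm u" using y(3) by simp
      qed (auto simp: L_def)
      also have "\<dots> \<le> 2 * (d * K) * L"
      proof -
        have "norm u \<le> d * K"
          using nu mult_right_mono[OF less_imp_le[OF cm] less_imp_le[OF K]] by linarith
        then show ?thesis using L by (intro mult_right_mono mult_left_mono) auto
      qed
      also have "\<dots> \<le> 2 * (e / (4 * K * L) * K) * L"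
        using K L by (intro mult_right_mono mult_left_mono) (auto simp: d_def)
      also have "\<dots> < e" using K L e by (simp add: field_simps)
      finally show ?thesis by (simp add: dist_norm)
    qed
    ultimately show "\<exists>d>0. \<forall>m\<in>cball 0 s0. dist m m0 < d \<longrightarrow> dist (R m) (R m0) < e" by blast
  qed
  then have "uniformly_continuous_on (cball 0 s0) R"
    by (intro compact_uniformly_continuous) auto
  with R that show ?thesis by blast
qed

text \<open>Suppose that \<open>1 - m x\<close> is invertible for all \<open>m\<close> in a disc.  The resolvents of the powers
  \<open>(s x) ^ n\<close> are averages of the resolvent of \<open>x\<close>, hence equicontinuous in \<open>s\<close>.  So if they tend to
  \<open>1\<close> at one \<open>s\<close>, they remain close to \<open>1\<close> for slightly larger \<open>s\<close>, and finitely many steps of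
  uniform length lead from \<open>0\<close> to the boundary of the disc.\<close>

lemma powers_bounded_in_disc:
  fixes x :: "'a::complex_banach_algebra"
  assumes inv: "\<And>m. m \<in> cball 0 s0 \<Longrightarrow> 1 - m *\<^sub>C x \<in> invertibles" and s: "0 \<le> s" "s < s0"
  shows "(\<lambda>n. s ^ n * norm (x ^ n)) \<longlonglongrightarrow> 0"
proof -
  obtain R where R: "\<And>m. m \<in> cball 0 s0 \<Longrightarrow> (1 - m *\<^sub>C x) * R m = 1"
    and uc: "uniformly_continuous_on (cball 0 s0) R"
    using uniform_resolvent[OF inv] by blast
  obtain d where d: "d > 0"
    and dR: "\<And>m m'. m \<in> cball 0 s0 \<Longrightarrow> m' \<in> cball 0 s0 \<Longrightarrow> dist m' m < d \<Longrightarrow> dist (R m') (R m) < 1/8"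
    using uc[unfolded uniformly_continuous_on_def, rule_format, of "1/8"] by auto
  \<comment> \<open>\<open>T n t\<close> is the inverse of \<open>1 - (t x) ^ n\<close>\<close>
  define T where "T n t = (1 / real n) *\<^sub>R (\<Sum>k<n. R (of_real t * cis (2 * pi * real k / real n)))" for n t
  have in_disc: "of_real t * cis a \<in> cball 0 s0" if "0 \<le> t" "t \<le> s0" for t a
    using that by (simp add: norm_mult)
  have T_inv: "(1 - t ^ n *\<^sub>R x ^ n) * T n t = 1" if "n > 0" "0 \<le> t" "t \<le> s0" for n t
  proof -
    have "(1 - (of_real t *\<^sub>C x) ^ n) * (\<Sum>k<n. R (of_real t * cis (2 * pi * real k / real n)))
        = real n *\<^sub>R 1"
      by (rule resolvent_average) (use that in_disc R in auto)
    moreover have "(of_real t *\<^sub>C x) ^ n = t ^ n *\<^sub>R x ^ n"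
      by (simp add: scaleC_power scaleR_scaleC)
    ultimately show ?thesis using that by (simp add: T_def)
  qed
  have T_near: "norm (T n t' - T n t) \<le> 1/8"
    if "n > 0" "0 \<le> t" "t \<le> s0" "0 \<le> t'" "t' \<le> s0" "\<bar>t' - t\<bar> < d" for n t t'
  proof -
    define D where "D k = R (of_real t' * cis (2 * pi * real k / real n))
        - R (of_real t * cis (2 * pi * real k / real n))" for k
    have D: "norm (D k) \<le> 1/8" for k
    proof -
      have "of_real t' * cis a - of_real t * cis a = of_real (t' - t) * cis a" for a
        by (simp add: algebra_simps)
      then have "dist (of_real t' * cis (2 * pi * real k / real n))
          (of_real t * cis (2 * pi * real k / real n)) < d"
        using that(6) by (simp only: dist_norm norm_mult norm_of_real) simp
      from dR[OF _ _ this] in_disc that show ?thesis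
        by (simp add: dist_norm less_imp_le D_def)
    qed
    have "T n t' - T n t = (1 / real n) *\<^sub>R sum D {..<n}"
      by (simp add: T_def D_def sum_subtractf scaleR_diff_right)
    moreover have "norm (sum D {..<n}) \<le> real n * (1/8)"
      using sum_norm_le[of "{..<n}" D "\<lambda>_. 1/8"] D by simp
    ultimately show ?thesis using that(1) by (simp add: field_simps)
  qed
  have step: "(\<lambda>n. t'' ^ n * norm (x ^ n)) \<longlonglongrightarrow> 0"
    if t: "(\<lambda>n. t ^ n * norm (x ^ n)) \<longlonglongrightarrow> 0" and bds: "0 \<le> t" "t \<le> t'" "t' < t + d" "t' \<le> s0"
      and t'': "0 \<le> t''" "t'' < t'" for t t' t''
  proof -
    \<comment> \<open>\<open>1/16\<close> puts \<open>T n t\<close> within \<open>1/8\<close> of \<open>1\<close>, hence \<open>T n t'\<close> within \<open>1/4\<close>, so that inverting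
      \<open>T n t'\<close> gives \<open>(t' x) ^ n\<close> of norm at most \<open>1\<close>\<close>
    have "eventually (\<lambda>n. t ^ n * norm (x ^ n) < 1/16) sequentially"
      using order_tendstoD(2)[OF t, of "1/16"] by simp
    then have ev: "eventually (\<lambda>n. t' ^ n * norm (x ^ n) \<le> 1) sequentially"
      using eventually_gt_at_top[of 0]
    proof eventually_elim
      case (elim n)
      let ?u = "t ^ n *\<^sub>R x ^ n"
      have nu: "norm ?u < 1/16" using elim bds by (simp add: power_abs)
      then obtain y where y: "(1 - ?u) * y = 1" "y * (1 - ?u) = 1"
          "norm (y - 1) \<le> norm ?u / (1 - norm ?u)"
        using near_one_inverse[of ?u] by auto
      have "(1 - ?u) * T n t = 1" using T_inv[of n t] bds elim by simp
      with y(2) have "y = T n t" by (rule left_right_inverse_eq)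
      have "norm ?u / (1 - norm ?u) \<le> (1/16) / (1/2)"
        using nu by (intro frac_le) auto
      with y(3) have "norm (y - 1) \<le> (1/16) / (1/2)" by (rule order_trans)
      then have "norm (y - 1) \<le> 1/8" by simp
      with \<open>y = T n t\<close> have "norm (T n t - 1) \<le> 1/8" by simp
      moreover have "norm (T n t' - T n t) \<le> 1/8" using bds elim by (intro T_near) auto
      ultimately have "norm (T n t' - 1) \<le> 1/4"
        using norm_triangle_ineq[of "T n t' - T n t" "T n t - 1"] by simp
      then have n4: "norm (1 - T n t') \<le> 1/4" by (simp add: norm_minus_commute)
      then obtain z where z: "(1 - (1 - T n t')) * z = 1" "z * (1 - (1 - T n t')) = 1"
          "norm (z - 1) \<le> norm (1 - T n t') / (1 - norm (1 - T n t'))"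
        using near_one_inverse[of "1 - T n t'"] by auto
      have "norm (1 - T n t') / (1 - norm (1 - T n t')) \<le> (1/4) / (1/2)"
        using n4 by (intro frac_le) auto
      with z(3) have "norm (z - 1) \<le> (1/4) / (1/2)" by (rule order_trans)
      then have "norm (z - 1) \<le> 1" by simp
      moreover have "(1 - t' ^ n *\<^sub>R x ^ n) * T n t' = 1" using T_inv[of n t'] bds elim by simp
      then have "z = 1 - t' ^ n *\<^sub>R x ^ n"
        using left_right_inverse_eq[of "1 - t' ^ n *\<^sub>R x ^ n" "T n t'" z] z(1) by simp
      then have "norm (z - 1) = t' ^ n * norm (x ^ n)" using bds by (simp add: power_abs)
      ultimately show ?case by simp
    qed
    show ?thesis
    proof (rule tendsto_sandwich)
      have t'0: "t' > 0" using t'' by simp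
      show "(\<lambda>n. 0) \<longlonglongrightarrow> (0::real)" by simp
      show "(\<lambda>n. (t'' / t') ^ n) \<longlonglongrightarrow> 0"
        using t'' by (intro LIMSEQ_realpow_zero) auto
      show "eventually (\<lambda>n. 0 \<le> t'' ^ n * norm (x ^ n)) sequentially" using t'' by simp
      show "eventually (\<lambda>n. t'' ^ n * norm (x ^ n) \<le> (t'' / t') ^ n) sequentially"
        using ev
      proof eventually_elim
        case (elim n)
        have "t'' ^ n * norm (x ^ n) = (t'' / t') ^ n * (t' ^ n * norm (x ^ n))"
          using t'0 by (simp add: power_divide)
        also have "\<dots> \<le> (t'' / t') ^ n * 1" using elim t'' by (intro mult_left_mono) auto
        finally show ?case by simp
      qed
    qed
  qed
  have steps: "(\<lambda>n. t ^ n * norm (x ^ n)) \<longlonglongrightarrow> 0" if "0 \<le> t" "t < s0" "t \<le> real j * (d / 2)" for j t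
    using that
  proof (induction j arbitrary: t)
    case 0
    then show ?case
      by (intro tendsto_eventually eventually_mono[OF eventually_gt_at_top[of 0]]) auto
  next
    case (Suc j)
    \<comment> \<open>the step from \<open>t0\<close> to \<open>t'\<close> is shorter than \<open>d\<close> and ends strictly above \<open>t\<close>\<close>
    define t0 where "t0 = max 0 (t - d / 2)"
    define t' where "t' = min s0 (t + d / 4)"
    have "(\<lambda>n. t0 ^ n * norm (x ^ n)) \<longlonglongrightarrow> 0"
      by (rule Suc.IH) (use Suc.prems d in \<open>auto simp: t0_def max_def algebra_simps\<close>)
    then show ?case
      by (rule step[where t' = t']) (use Suc.prems d in \<open>auto simp: t0_def t'_def\<close>)
  qed
  obtain j where "s / (d / 2) \<le> real j" using real_arch_simple by blast
  then have "s \<le> real j * (d / 2)" using d by (simp add: field_simps)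
  then show ?thesis by (rule steps[OF s])
qed

text \<open>The nontrivial half of the spectral radius formula.\<close>

lemma power_bound_from_spectrum:
  fixes x :: "'a::complex_banach_algebra"
  assumes "spectrum x \<subseteq> cball 0 r" "0 \<le> r" "r < r'"
  obtains C where "\<And>n. norm (x ^ n) \<le> C * r' ^ n"
proof -
  define r1 where "r1 = (r + r') / 2"
  have r1: "r < r1" "r1 < r'" "0 < r1" "0 < r'" using assms by (auto simp: r1_def)
  have inv: "1 - m *\<^sub>C x \<in> invertibles" if m: "m \<in> cball 0 (1 / r1)" for m
  proof (cases "m = 0")
    case False
    have "r1 \<le> cmod (1 / m)" using m False r1 by (simp add: norm_divide field_simps)
    then have "1 / m \<notin> spectrum x" using assms(1) r1 by auto
    moreover have "1 - m *\<^sub>C x = m *\<^sub>C ((1 / m) *\<^sub>C 1 - x)"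
      using False by (simp add: scaleC_algebra scaleC_scaleC)
    ultimately show ?thesis using False by (simp add: not_in_spectrum_iff invertible_scaleC_iff)
  qed simp
  have "(\<lambda>n. (1 / r') ^ n * norm (x ^ n)) \<longlonglongrightarrow> 0"
  proof (rule powers_bounded_in_disc)
    show "1 - m *\<^sub>C x \<in> invertibles" if "m \<in> cball 0 (1 / r1)" for m using that by (rule inv)
    show "0 \<le> 1 / r'" "1 / r' < 1 / r1" using r1 by (auto intro: divide_strict_left_mono)
  qed
  then have "Bseq (\<lambda>n. (1 / r') ^ n * norm (x ^ n))"
    by (intro convergent_imp_Bseq convergentI)
  then obtain C where C: "\<And>n. norm ((1 / r') ^ n * norm (x ^ n)) \<le> C" unfolding Bseq_def by blast
  have "norm (x ^ n) \<le> C * r' ^ n" for n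
    using C[of n] r1(4) by (simp add: power_divide field_simps abs_mult)
  then show ?thesis by (rule that)
qed

lemma commuting_power:
  fixes x :: "'a::monoid_mult"
  assumes "x * y = y * x" shows "x ^ n * y = y * x ^ n"
proof (induction n)
  case (Suc n)
  have "x ^ Suc n * y = x * (x ^ n * y)" by (simp add: mult.assoc)
  also have "\<dots> = (x * y) * x ^ n" unfolding Suc by (simp add: mult.assoc)
  finally show ?case unfolding assms by (simp add: mult.assoc)
qed simp

lemma spectrum_closure_bound:
  fixes x :: "'a::complex_banach_algebra"
  assumes "\<And>e. e > 0 \<Longrightarrow> spectrum x \<subseteq> cball 0 (r + e)" shows "spectrum x \<subseteq> cball 0 r"
proof
  fix l assume l: "l \<in> spectrum x"
  have "cmod l \<le> r + e" if "e > 0" for e using assms[OF that] l by auto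
  then show "l \<in> cball 0 r" by (simp add: field_le_epsilon)
qed

text \<open>The spectral radius is submultiplicative and, by the next lemma, subadditive on commuting
  elements: both follow from growth estimates of powers.\<close>

lemma spectrum_commuting_mult:
  fixes x y :: "'a::complex_banach_algebra"
  assumes "spectrum x \<subseteq> cball 0 r" "spectrum y \<subseteq> cball 0 s" "x * y = y * x" "0 \<le> r" "0 \<le> s"
  shows "spectrum (x * y) \<subseteq> cball 0 (r * s)"
proof (rule spectrum_closure_bound)
  fix e :: real assume e: "e > 0"
  define d where "d = min 1 (e / (r + s + 1))"
  have d: "d > 0" "d \<le> 1" "d * (r + s + 1) \<le> e"
  proof -
    have rs: "0 < r + s + 1" using assms by simp
    show "d > 0" "d \<le> 1" using e rs by (auto simp: d_def)
    have "d * (r + s + 1) \<le> (e / (r + s + 1)) * (r + s + 1)"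
      using rs by (intro mult_right_mono) (auto simp: d_def)
    then show "d * (r + s + 1) \<le> e" using rs by simp
  qed
  obtain C where C: "\<And>n. norm (x ^ n) \<le> C * (r + d) ^ n"
    using power_bound_from_spectrum[of x r "r + d"] assms d by auto
  obtain D where D: "\<And>n. norm (y ^ n) \<le> D * (s + d) ^ n"
    using power_bound_from_spectrum[of y s "s + d"] assms d by auto
  have pow: "(x * y) ^ n = x ^ n * y ^ n" for n
  proof (induction n)
    case (Suc n)
    have "(x * y) ^ Suc n = x * (y * x ^ n) * y ^ n" by (simp add: Suc mult.assoc)
    also have "y * x ^ n = x ^ n * y" using commuting_power[OF assms(3)] by simp
    finally show ?case by (simp add: mult.assoc)
  qed simp
  have "norm ((x * y) ^ n) \<le> (C * D) * ((r + d) * (s + d)) ^ n" for n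
  proof -
    have "norm ((x * y) ^ n) \<le> norm (x ^ n) * norm (y ^ n)" by (simp add: pow norm_mult_ineq)
    also have "\<dots> \<le> (C * (r + d) ^ n) * (D * (s + d) ^ n)"
      using C[of n] D[of n] by (intro mult_mono) (auto intro: order_trans[OF norm_ge_zero])
    finally show ?thesis by (simp add: power_mult_distrib mult_ac)
  qed
  then have "spectrum (x * y) \<subseteq> cball 0 ((r + d) * (s + d))"
    by (rule spectrum_power_bound) (use assms d in auto)
  moreover have "(r + d) * (s + d) \<le> r * s + e"
  proof -
    have "d * d \<le> d * 1" using d by (intro mult_left_mono) auto
    then show ?thesis using d(3) by (simp add: algebra_simps)
  qed
  ultimately show "spectrum (x * y) \<subseteq> cball 0 (r * s + e)" by auto
qed

lemma spectrum_commuting_add: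
  fixes x y :: "'a::complex_banach_algebra"
  assumes "spectrum x \<subseteq> cball 0 r" "spectrum y \<subseteq> cball 0 s" "x * y = y * x" "0 \<le> r" "0 \<le> s"
  shows "spectrum (x + y) \<subseteq> cball 0 (r + s)"
proof (rule spectrum_closure_bound)
  fix e :: real assume e: "e > 0"
  obtain C where C: "\<And>n. norm (x ^ n) \<le> C * (r + e/2) ^ n"
    using power_bound_from_spectrum[of x r "r + e/2"] assms e by auto
  obtain D where D: "\<And>n. norm (y ^ n) \<le> D * (s + e/2) ^ n"
    using power_bound_from_spectrum[of y s "s + e/2"] assms e by auto
  \<comment> \<open>carrying the factors \<open>x ^ i * y ^ j\<close> along avoids the binomial theorem for commuting elements\<close>
  have "norm (x ^ i * y ^ j * (x + y) ^ n) \<le> (C * (r + e/2) ^ i) * (D * (s + e/2) ^ j) * (r + s + e) ^ n"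
    for i j n
  proof (induction n arbitrary: i j)
    case 0
    have "norm (x ^ i * y ^ j) \<le> norm (x ^ i) * norm (y ^ j)" by (rule norm_mult_ineq)
    also have "\<dots> \<le> (C * (r + e/2) ^ i) * (D * (s + e/2) ^ j)"
      using C[of i] D[of j] by (intro mult_mono) (auto intro: order_trans[OF norm_ge_zero])
    finally show ?case by simp
  next
    case (Suc n)
    have yx: "y ^ j * x = x * y ^ j" using commuting_power[of y x j] assms(3) by simp
    have "x ^ i * y ^ j * (x + y) ^ Suc n = x ^ i * (y ^ j * x) * (x + y) ^ n + x ^ i * (y ^ j * y) * (x + y) ^ n"
      by (simp add: algebra_simps)
    also have "\<dots> = x ^ Suc i * y ^ j * (x + y) ^ n + x ^ i * y ^ Suc j * (x + y) ^ n"
      by (simp add: yx power_Suc2 mult.assoc del: power_Suc)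
    also have "norm \<dots> \<le> norm (x ^ Suc i * y ^ j * (x + y) ^ n) + norm (x ^ i * y ^ Suc j * (x + y) ^ n)"
      by (rule norm_triangle_ineq)
    also have "\<dots> \<le> (C * (r + e/2) ^ Suc i) * (D * (s + e/2) ^ j) * (r + s + e) ^ n
        + (C * (r + e/2) ^ i) * (D * (s + e/2) ^ Suc j) * (r + s + e) ^ n"
      by (intro add_mono Suc)
    also have "\<dots> = (C * (r + e/2) ^ i) * (D * (s + e/2) ^ j) * (r + s + e) ^ Suc n"
      by (simp add: algebra_simps)
    finally show ?case .
  qed
  from this[of 0 0] have "norm ((x + y) ^ n) \<le> (C * D) * (r + s + e) ^ n" for n by simp
  then show "spectrum (x + y) \<subseteq> cball 0 (r + s + e)"
    by (rule spectrum_power_bound) (use assms e in auto)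
qed

section \<open>Self-adjoint elements and their functional calculus\<close>

lemma cstar_0 [simp]: "cstar (0::'a::cstar_algebra) = 0"
  using cstar_add[of 0 "0::'a"] by simp

lemma cstar_1 [simp]: "cstar (1::'a::cstar_algebra) = 1"
  by (metis cstar_cstar cstar_mult mult_1_left mult_1_right)

lemma cstar_scaleR: "cstar (r *\<^sub>R x) = r *\<^sub>R cstar (x::'a::cstar_algebra)"
  by (simp add: scaleR_scaleC cstar_scaleC)

lemma cstar_minus: "cstar (- x) = - cstar (x::'a::cstar_algebra)"
  using cstar_scaleR[of "-1" x] by simp

lemma cstar_diff: "cstar (x - y) = cstar x - cstar (y::'a::cstar_algebra)"
  using cstar_add[of x "- y"] by (simp add: cstar_minus)

lemmas cstar_simps = cstar_add cstar_diff cstar_minus cstar_scaleR cstar_scaleC cstar_mult cstar_cstar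

lemma cstar_power: "cstar (x ^ n) = cstar (x::'a::cstar_algebra) ^ n"
  by (induction n) (simp_all add: cstar_mult power_commutes)

lemma norm_cstar [simp]: "norm (cstar x) = norm (x::'a::cstar_algebra)"
proof -
  have *: "norm y \<le> norm (cstar y)" for y :: 'a
  proof (cases "y = 0")
    case False
    have "norm y * norm y \<le> norm (cstar y) * norm y"
      using norm_cstar_mult[of y] norm_mult_ineq[of "cstar y" y] by (simp add: power2_eq_square)
    then show ?thesis using False by simp
  qed simp
  show ?thesis using *[of x] *[of "cstar x"] by (simp add: cstar_cstar)
qed

lemma norm_mult_cstar: "norm (x * cstar x) = (norm (x::'a::cstar_algebra))\<^sup>2"
  using norm_cstar_mult[of "cstar x"] by (simp add: cstar_cstar)

lemma cstar_mult_eq_0: "cstar x * x = 0 \<longleftrightarrow> x = (0::'a::cstar_algebra)"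
  using norm_cstar_mult[of x] by auto

lemma mult_cstar_eq_0: "x * cstar x = 0 \<longleftrightarrow> x = (0::'a::cstar_algebra)"
  using norm_mult_cstar[of x] by auto

lemma cstar_inverse_selfadjoint:
  fixes x :: "'a::cstar_algebra"
  assumes "x * y = 1" "y * x = 1" "cstar x = x" shows "cstar y = y"
proof -
  have "cstar y * x = 1" using assms by (metis cstar_1 cstar_mult)
  then show ?thesis by (rule left_right_inverse_eq[OF _ assms(1)])
qed

definition real_part :: "'a::cstar_algebra \<Rightarrow> 'a" where
  "real_part x = (1/2) *\<^sub>R (x + cstar x)"

definition imag_part :: "'a::cstar_algebra \<Rightarrow> 'a" where
  "imag_part x = (- \<i> / 2) *\<^sub>C (x - cstar x)"

lemma selfadjoint_parts [simp]: "cstar (real_part x) = real_part x" "cstar (imag_part x) = imag_part x"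
  by (simp_all add: real_part_def imag_part_def cstar_simps scaleC_algebra algebra_simps)

lemma real_imag_part: "x = real_part x + \<i> *\<^sub>C imag_part x"
  by (simp add: real_part_def imag_part_def scaleC_scaleC scaleR_scaleC scaleC_algebra)
    (simp add: complex_scale.scale_left_distrib[symmetric])

lemma parts_unique:
  assumes "cstar u = u" "cstar v = v" "x = u + \<i> *\<^sub>C v"
  shows "real_part x = u" "imag_part x = v"
proof -
  have c: "cstar x = u - \<i> *\<^sub>C v" by (simp add: assms(3) cstar_simps assms(1,2))
  have "x + cstar x = 2 *\<^sub>R u" "x - cstar x = (2 * \<i>) *\<^sub>C v"
    unfolding c unfolding assms(3)
    by (simp_all only: scaleR_2 mult_2 complex_scale.scale_left_distrib) simp_all
  then show "real_part x = u" "imag_part x = v"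
    by (simp_all add: real_part_def imag_part_def scaleC_scaleC)
qed

lemma norm_power_selfadjoint:
  fixes h :: "'a::cstar_algebra"
  assumes "cstar h = h" shows "norm (h ^ (2 ^ n)) = norm h ^ (2 ^ n)"
proof (induction n)
  case (Suc n)
  have "h ^ (2 ^ Suc n) = cstar (h ^ 2 ^ n) * h ^ 2 ^ n"
    by (simp add: cstar_power assms mult_2 power_add)
  then show ?case using Suc by (simp add: norm_cstar_mult power_mult[symmetric] mult.commute)
qed simp

text \<open>The C*-identity gives \<open>norm (h ^ (2 ^ n)) = norm h ^ (2 ^ n)\<close>, so by the spectral radius formula
  the norm of a self-adjoint element is its spectral radius.\<close>

lemma norm_le_from_spectrum:
  fixes h :: "'a::cstar_algebra"
  assumes "cstar h = h" "spectrum h \<subseteq> cball 0 r" "0 \<le> r"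
  shows "norm h \<le> r"
proof (rule field_le_epsilon)
  fix e :: real assume e: "e > 0"
  obtain C where C: "\<And>n. norm (h ^ n) \<le> C * (r + e) ^ n"
    using power_bound_from_spectrum[of h r "r + e"] assms e by auto
  show "norm h \<le> r + e"
  proof (rule ccontr)
    assume "\<not> norm h \<le> r + e"
    then have q: "1 < norm h / (r + e)" using e assms by (simp add: field_simps)
    then obtain n where n: "C < (norm h / (r + e)) ^ n" using real_arch_pow by blast
    have "(norm h / (r + e)) ^ n \<le> (norm h / (r + e)) ^ (2 ^ n)"
      using q by (intro power_increasing) (auto intro: less_imp_le)
    moreover have "norm h ^ (2 ^ n) \<le> C * (r + e) ^ (2 ^ n)"
      using C[of "2 ^ n"] norm_power_selfadjoint[OF assms(1)] by simp
    then have "(norm h / (r + e)) ^ (2 ^ n) \<le> C"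
      using e assms by (simp add: power_divide field_simps)
    ultimately show False using n by simp
  qed
qed

lemma selfadjoint_eq_0:
  fixes h :: "'a::cstar_algebra"
  assumes "cstar h = h" "spectrum h \<subseteq> {0}" shows "h = 0"
  using norm_le_from_spectrum[of h 0] assms by auto

text \<open>An empty spectrum would force \<open>h = 0\<close>, whose spectrum is not empty.\<close>

lemma selfadjoint_spectrum_nonempty:
  fixes h :: "'a::cstar_algebra"
  assumes "cstar h = h" shows "spectrum h \<noteq> {}"
  using selfadjoint_eq_0[OF assms] by force

text \<open>If \<open>a + i b\<close> lies in the spectrum of \<open>h\<close>, then \<open>a + i (b + t)\<close> lies in the spectrum of \<open>h + i t\<close>,
  and the square of its modulus is at most the norm of \<open>(h - i t) (h + i t) = h\<^sup>2 + t\<^sup>2\<close>.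
  As \<open>t\<close> varies, only \<open>b = 0\<close> is compatible with this.\<close>

lemma selfadjoint_spectrum_real:
  fixes h :: "'a::cstar_algebra"
  assumes h: "cstar h = h" and l: "l \<in> spectrum h" shows "l \<in> \<real>"
proof -
  have bound: "(Re l)\<^sup>2 + (Im l + t)\<^sup>2 \<le> (norm h)\<^sup>2 + t\<^sup>2" for t
  proof -
    let ?k = "h + (\<i> * of_real t) *\<^sub>C 1"
    have "l + \<i> * of_real t \<in> spectrum ?k" using l by (simp add: spectrum_shift)
    then have "cmod (l + \<i> * of_real t) \<le> norm ?k" using spectrum_norm_bound[of ?k] by auto
    then have "(cmod (l + \<i> * of_real t))\<^sup>2 \<le> (norm ?k)\<^sup>2" by (intro power_mono) auto
    also have "(norm ?k)\<^sup>2 = norm (cstar ?k * ?k)" by (simp add: norm_cstar_mult)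
    also have "cstar ?k * ?k = h * h + (t\<^sup>2) *\<^sub>R 1"
      by (simp add: cstar_simps h algebra_simps scaleC_algebra scaleC_scaleC scaleR_scaleC power2_eq_square)
    also have "norm \<dots> \<le> norm h * norm h + t\<^sup>2"
      using norm_triangle_ineq[of "h * h" "t\<^sup>2 *\<^sub>R 1"] norm_mult_ineq[of h h] by simp
    finally show ?thesis by (simp add: cmod_power2) (simp add: power2_eq_square)
  qed
  have "Im l = 0"
  proof (rule ccontr)
    assume "Im l \<noteq> 0"
    define t where "t = ((norm h)\<^sup>2 + 1) / (2 * Im l)"
    have "2 * Im l * t = (norm h)\<^sup>2 + 1" using \<open>Im l \<noteq> 0\<close> by (simp add: t_def)
    moreover have "(Re l)\<^sup>2 + (Im l)\<^sup>2 + 2 * Im l * t \<le> (norm h)\<^sup>2"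
      using bound[of t] by (simp add: power2_sum)
    moreover have "0 \<le> (Re l)\<^sup>2" "0 \<le> (Im l)\<^sup>2" by simp_all
    ultimately show False by linarith
  qed
  then show ?thesis by (simp add: complex_is_Real_iff)
qed

lemma selfadjoint_nonreal_invertible:
  fixes h :: "'a::cstar_algebra"
  assumes "cstar h = h" "Im l \<noteq> 0" shows "h + l *\<^sub>C 1 \<in> invertibles"
proof -
  have "- l \<notin> spectrum h"
    using selfadjoint_spectrum_real[OF assms(1), of "- l"] assms(2) by (auto simp: complex_is_Real_iff)
  moreover have "(- l) *\<^sub>C 1 - h = - (h + l *\<^sub>C 1)" by simp
  ultimately show ?thesis by (metis not_in_spectrum_iff invertible_minus_iff)
qed

definition complex_poly_eval :: "complex poly \<Rightarrow> 'a::complex_banach_algebra \<Rightarrow> 'a" where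
  "complex_poly_eval p x = fold_coeffs (\<lambda>a y. a *\<^sub>C 1 + x * y) p 0"

lemma complex_poly_eval_0 [simp]: "complex_poly_eval 0 x = 0"
  by (simp add: complex_poly_eval_def)

lemma complex_poly_eval_pCons [simp]:
  "complex_poly_eval (pCons a p) x = a *\<^sub>C 1 + x * complex_poly_eval p x"
  by (cases "p = 0 \<and> a = 0") (auto simp: complex_poly_eval_def)

lemma complex_poly_eval_linear_mult:
  "complex_poly_eval ([:- r, 1:] * p) x = (x - r *\<^sub>C 1) * complex_poly_eval p x"
proof -
  have smult: "complex_poly_eval (smult c q) x = c *\<^sub>C complex_poly_eval q x" for c q
    by (induction q) (simp_all add: scaleC_algebra scaleC_scaleC)
  have add: "complex_poly_eval (p + q) x = complex_poly_eval p x + complex_poly_eval q x" for p q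
    by (induction p q rule: poly_induct2) (simp_all add: scaleC_algebra algebra_simps)
  have "[:- r, 1:] * p = smult (- r) p + pCons 0 p" by simp
  then show ?thesis by (simp only: smult add) (simp add: left_diff_distrib mult_scaleC_left)
qed

text \<open>The factors \<open>x - r\<close> belonging to the roots \<open>r\<close> of \<open>p\<close> are all invertible.\<close>

lemma complex_poly_eval_invertible:
  assumes "p \<noteq> 0" "\<And>m. m \<in> spectrum x \<Longrightarrow> poly p m \<noteq> 0"
  shows "complex_poly_eval p x \<in> invertibles"
  using assms
proof (induction "degree p" arbitrary: p)
  case 0
  then obtain c where "p = [:c:]" by (metis degree_eq_zeroE)
  with 0 show ?case by (simp add: invertible_scaleC_iff)
next
  case (Suc n)
  then have "\<not> constant (poly p)" by (simp add: constant_degree)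
  then obtain r where r: "poly p r = 0" using fundamental_theorem_of_algebra by blast
  then obtain q where q: "p = [:- r, 1:] * q" by (auto simp: poly_eq_0_iff_dvd elim: dvdE)
  have q0: "q \<noteq> 0" using Suc.prems(1) q by auto
  then have "degree p = Suc (degree q)" unfolding q by (subst degree_mult_eq) auto
  then have "complex_poly_eval q x \<in> invertibles"
    using Suc q q0 by (intro Suc.hyps(1)) auto
  moreover have "r \<notin> spectrum x" using Suc.prems(2) r by auto
  then have "- (x - r *\<^sub>C 1) \<in> invertibles" by (simp add: not_in_spectrum_iff)
  then have "x - r *\<^sub>C 1 \<in> invertibles" by (simp only: invertible_minus_iff)
  ultimately show ?case unfolding q complex_poly_eval_linear_mult by (rule invertible_mult[rotated])
qed

lemma spectrum_poly_eval:
  assumes "l \<in> spectrum (complex_poly_eval p x)" "spectrum x \<noteq> {}"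
  obtains m where "m \<in> spectrum x" "l = poly p m"
proof (cases "p - [:l:] = 0")
  case True
  then have "p = [:l:]" by simp
  then have "l = poly p m" for m by simp
  then show ?thesis using assms(2) that by blast
next
  case False
  have "complex_poly_eval (p - [:l:]) x = complex_poly_eval p x - l *\<^sub>C 1"
    by (cases p) (simp add: scaleC_algebra)
  also have "\<dots> = - (l *\<^sub>C 1 - complex_poly_eval p x)" by simp
  finally have "complex_poly_eval (p - [:l:]) x \<notin> invertibles"
    using assms(1) invertible_minus_iff by (metis not_in_spectrum_iff)
  then show ?thesis using complex_poly_eval_invertible[OF False, of x] that by auto
qed

definition poly_eval :: "real poly \<Rightarrow> 'a::real_algebra_1 \<Rightarrow> 'a" where
  "poly_eval p x = fold_coeffs (\<lambda>a y. a *\<^sub>R 1 + x * y) p 0"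

lemma poly_eval_0 [simp]: "poly_eval 0 x = 0"
  by (simp add: poly_eval_def)

lemma poly_eval_pCons [simp]: "poly_eval (pCons a p) x = a *\<^sub>R 1 + x * poly_eval p x"
  by (cases "p = 0 \<and> a = 0") (auto simp: poly_eval_def)

lemma poly_eval_smult: "poly_eval (smult c q) x = c *\<^sub>R poly_eval q x"
  by (induction q) (simp_all add: scaleR_add_right)

lemma poly_eval_add: "poly_eval (p + q) x = poly_eval p x + poly_eval q x"
  by (induction p q rule: poly_induct2) (simp_all add: scaleR_add_left algebra_simps)

lemma poly_eval_diff: "poly_eval (p - q) x = poly_eval p x - poly_eval q x"
  using poly_eval_add[of p "smult (-1) q" x] by (simp only: poly_eval_smult) simp

lemma poly_eval_mult: "poly_eval (p * q) x = poly_eval p x * poly_eval q x"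
  by (induction p) (simp_all add: poly_eval_add poly_eval_smult algebra_simps)

lemma poly_eval_commute: "y * x = x * y \<Longrightarrow> y * poly_eval p x = poly_eval p x * y"
proof (induction p)
  case (pCons a p)
  have "y * (x * poly_eval p x) = x * (y * poly_eval p x)"
    by (simp add: pCons.prems mult.assoc[symmetric])
  also have "\<dots> = (x * poly_eval p x) * y" using pCons by (simp add: mult.assoc)
  finally show ?case by (simp add: distrib_left distrib_right)
qed simp

lemma poly_eval_complex:
  "poly_eval p (x::'a::complex_banach_algebra) = complex_poly_eval (map_poly of_real p) x"
  by (induction p) (simp_all add: map_poly_pCons scaleR_scaleC)

lemma poly_map_of_real: "poly (map_poly of_real p) (complex_of_real t) = of_real (poly p t)"
  by (induction p) (simp_all add: map_poly_pCons)

lemma cstar_poly_eval: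
  fixes h :: "'a::cstar_algebra"
  assumes "cstar h = h" shows "cstar (poly_eval p h) = poly_eval p h"
proof (induction p)
  case (pCons a p)
  then show ?case
    using poly_eval_commute[of h h p] by (simp add: cstar_simps assms)
qed simp

lemma norm_poly_eval:
  fixes h :: "'a::cstar_algebra"
  assumes h: "cstar h = h" and r: "\<And>t. complex_of_real t \<in> spectrum h \<Longrightarrow> \<bar>poly p t\<bar> \<le> r"
  shows "norm (poly_eval p h) \<le> r"
proof -
  obtain l where l: "l \<in> spectrum h" using selfadjoint_spectrum_nonempty[OF h] by blast
  then obtain t where "l = of_real t" using selfadjoint_spectrum_real[OF h l] by (auto elim: Reals_cases)
  with l r have r0: "0 \<le> r" by (meson abs_ge_zero order_trans)
  have "spectrum (poly_eval p h) \<subseteq> cball 0 r"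
  proof
    fix l assume "l \<in> spectrum (poly_eval p h)"
    then obtain m where m: "m \<in> spectrum h" "l = poly (map_poly of_real p) m"
      unfolding poly_eval_complex using selfadjoint_spectrum_nonempty[OF h] by (rule spectrum_poly_eval)
    then obtain t where "m = of_real t" using selfadjoint_spectrum_real[OF h] by (auto elim: Reals_cases)
    then show "l \<in> cball 0 r" using r m by (simp add: poly_map_of_real)
  qed
  then show ?thesis by (rule norm_le_from_spectrum[OF cstar_poly_eval[OF h] _ r0])
qed

text \<open>Approximations of \<open>f\<close> count on the spectrum of \<open>h\<close> only, so that the functional calculus depends
  on \<open>f\<close> through its values there.\<close>

definition approximates :: "'a::cstar_algebra \<Rightarrow> (real \<Rightarrow> real) \<Rightarrow> 'a \<Rightarrow> real \<Rightarrow> real poly \<Rightarrow> bool" where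
  "approximates h f a e p \<longleftrightarrow>
     (\<forall>t. complex_of_real t \<in> spectrum h \<longrightarrow> \<bar>f t - poly p t\<bar> \<le> e) \<and> norm (a - poly_eval p h) \<le> e"

text \<open>A polynomial at a self-adjoint \<open>h\<close> has norm at most its supremum on the spectrum, so values of
  uniform polynomial approximations of \<open>f\<close> converge.  The result is \<open>f\<close> applied to \<open>h\<close>.\<close>

definition fun_calc :: "'a::cstar_algebra \<Rightarrow> (real \<Rightarrow> real) \<Rightarrow> 'a" where
  "fun_calc h f = (THE a. \<forall>e>0. \<exists>p. approximates h f a e p)"

lemma polynomial_approximation:
  fixes h :: "'a::cstar_algebra"
  assumes "continuous_on UNIV f" "e > 0"
  obtains p where "\<And>t. complex_of_real t \<in> spectrum h \<Longrightarrow> \<bar>f t - poly p t\<bar> \<le> e"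
proof -
  obtain g where g: "real_polynomial_function g" "\<And>t. t \<in> {- norm h..norm h} \<Longrightarrow> \<bar>f t - g t\<bar> < e"
    using Stone_Weierstrass_real_polynomial_function[of "{- norm h..norm h}" f e] assms
    by (metis compact_Icc continuous_on_subset top_greatest)
  from g(1) obtain a n where an: "g = (\<lambda>x. \<Sum>i\<le>n. a i * x ^ i)"
    unfolding real_polynomial_function_iff_sum by blast
  define p where "p = (\<Sum>i\<le>n. monom (a i) i)"
  have "poly p t = g t" for t by (simp add: p_def an poly_sum poly_monom)
  moreover have "t \<in> {- norm h..norm h}" if "complex_of_real t \<in> spectrum h" for t
    using that spectrum_norm_bound[of h] by auto
  ultimately show ?thesis using g(2) that[of p] by (metis less_imp_le)
qed

lemma approximates_close:
  fixes h :: "'a::cstar_algebra"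
  assumes h: "cstar h = h" and "approximates h f a e p" "approximates h f b d q"
  shows "norm (a - b) \<le> 2 * (e + d)"
proof -
  have n1: "norm (poly_eval (p - q) h) \<le> e + d"
  proof (rule norm_poly_eval[OF h])
    fix t assume "complex_of_real t \<in> spectrum h"
    then have "\<bar>f t - poly p t\<bar> \<le> e" "\<bar>f t - poly q t\<bar> \<le> d"
      using assms(2,3) by (auto simp: approximates_def)
    then show "\<bar>poly (p - q) t\<bar> \<le> e + d" by simp
  qed
  have n2: "norm (a - poly_eval p h) \<le> e" "norm (b - poly_eval q h) \<le> d"
    using assms(2,3) by (auto simp: approximates_def)
  have "norm (((a - poly_eval p h) - (b - poly_eval q h)) + poly_eval (p - q) h) \<le> (e + d) + (e + d)"
    using norm_triangle_le_diff[OF add_mono[OF n2]] n1 by (rule norm_triangle_mono)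
  then show ?thesis by (simp add: poly_eval_diff)
qed

lemma fun_calc_unique:
  fixes h :: "'a::cstar_algebra"
  assumes h: "cstar h = h" and a: "\<And>e. e > 0 \<Longrightarrow> \<exists>p. approximates h f a e p"
  shows "fun_calc h f = a"
  unfolding fun_calc_def
proof (rule the_equality)
  show "\<forall>e>0. \<exists>p. approximates h f a e p" using a by blast
  fix b assume b: "\<forall>e>0. \<exists>p. approximates h f b e p"
  have "norm (b - a) \<le> 0 + e" if e: "e > 0" for e
  proof -
    obtain p q where "approximates h f b (e/4) p" "approximates h f a (e/4) q"
      using a[of "e/4"] b[rule_format, of "e/4"] e by auto
    from approximates_close[OF h this] show ?thesis by simp
  qed
  then have "norm (b - a) \<le> 0" by (rule field_le_epsilon)
  then show "b = a" by simp
qed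

lemma fun_calc_approx:
  fixes h :: "'a::cstar_algebra"
  assumes h: "cstar h = h" and f: "continuous_on UNIV f" and e: "e > 0"
  shows "\<exists>p. approximates h f (fun_calc h f) e p"
proof -
  have "\<exists>p. \<forall>t. complex_of_real t \<in> spectrum h \<longrightarrow> \<bar>f t - poly p t\<bar> \<le> inverse (real (Suc n))" for n
    using polynomial_approximation[OF f, of "inverse (real (Suc n))" h] by auto
  then obtain p where p: "\<And>n t. complex_of_real t \<in> spectrum h \<Longrightarrow>
      \<bar>f t - poly (p n) t\<bar> \<le> inverse (real (Suc n))"
    by metis
  have app: "approximates h f (poly_eval (p n) h) (inverse (real (Suc n))) (p n)" for n
    using p by (simp add: approximates_def)
  have "Cauchy (\<lambda>n. poly_eval (p n) h)"
  proof (rule metric_CauchyI)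
    fix e :: real assume e: "0 < e"
    then obtain N where N: "inverse (real (Suc N)) < e / 4" using reals_Archimedean[of "e/4"] by auto
    have "dist (poly_eval (p m) h) (poly_eval (p n) h) < e" if "N \<le> m" "N \<le> n" for m n
    proof -
      have "inverse (real (Suc m)) < e / 4" "inverse (real (Suc n)) < e / 4"
        using that by (intro le_less_trans[OF le_imp_inverse_le N]; simp)+
      then have "2 * (inverse (real (Suc m)) + inverse (real (Suc n))) < 2 * (e / 4 + e / 4)"
        by (intro mult_strict_left_mono add_strict_mono) auto
      with approximates_close[OF h app[of m] app[of n]] show ?thesis by (simp add: dist_norm)
    qed
    then show "\<exists>M. \<forall>m\<ge>M. \<forall>n\<ge>M. dist (poly_eval (p m) h) (poly_eval (p n) h) < e" by blast
  qed
  then obtain a where a: "(\<lambda>n. poly_eval (p n) h) \<longlonglongrightarrow> a" using Cauchy_convergent convergent_def by blast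
  have ex: "\<exists>q. approximates h f a e q" if "e > 0" for e
  proof -
    have "eventually (\<lambda>n. dist (poly_eval (p n) h) a < e) sequentially" using a that by (rule tendstoD)
    moreover have "eventually (\<lambda>n. inverse (real (Suc n)) < e) sequentially"
      using order_tendstoD(2)[OF LIMSEQ_inverse_real_of_nat that] .
    ultimately have "eventually (\<lambda>n. approximates h f a e (p n)) sequentially"
    proof eventually_elim
      case (elim n)
      then show ?case using p[of _ n]
        by (auto simp: approximates_def dist_norm norm_minus_commute intro: order_trans less_imp_le)
    qed
    then show ?thesis using eventually_happens' sequentially_bot by blast
  qed
  with fun_calc_unique[OF h ex] e show ?thesis by simp
qed

lemma norm_fun_calc:
  fixes h :: "'a::cstar_algebra"
  assumes h: "cstar h = h" and f: "continuous_on UNIV f"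
    and r: "\<And>t. complex_of_real t \<in> spectrum h \<Longrightarrow> \<bar>f t\<bar> \<le> r"
  shows "norm (fun_calc h f) \<le> r"
proof (rule field_le_epsilon)
  fix e :: real assume e: "e > 0"
  obtain p where p: "approximates h f (fun_calc h f) (e/2) p"
    using fun_calc_approx[OF h f, of "e/2"] e by auto
  have "norm (poly_eval p h) \<le> r + e/2"
  proof (rule norm_poly_eval[OF h])
    fix t assume t: "complex_of_real t \<in> spectrum h"
    then have "\<bar>f t - poly p t\<bar> \<le> e/2" using p by (auto simp: approximates_def)
    with r[OF t] show "\<bar>poly p t\<bar> \<le> r + e/2" by linarith
  qed
  moreover have "norm (fun_calc h f - poly_eval p h) \<le> e/2" using p by (simp add: approximates_def)
  ultimately show "norm (fun_calc h f) \<le> r + e"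
    using norm_triangle_ineq2[of "fun_calc h f" "poly_eval p h"] by linarith
qed

lemma fun_calc_poly:
  fixes h :: "'a::cstar_algebra"
  assumes "cstar h = h" shows "fun_calc h (poly p) = poly_eval p h"
  using assms by (rule fun_calc_unique) (auto simp: approximates_def intro!: exI[of _ p])

lemma fun_calc_id: "cstar (h::'a::cstar_algebra) = h \<Longrightarrow> fun_calc h (\<lambda>t. t) = h"
  using fun_calc_poly[of h "[:0, 1:]"] by (simp add: poly_pCons[abs_def])

lemma fun_calc_const: "cstar (h::'a::cstar_algebra) = h \<Longrightarrow> fun_calc h (\<lambda>t. c) = c *\<^sub>R 1"
  using fun_calc_poly[of h "[:c:]"] by (simp add: poly_pCons[abs_def])

lemma fun_calc_add:
  fixes h :: "'a::cstar_algebra"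
  assumes h: "cstar h = h" and f: "continuous_on UNIV f" and g: "continuous_on UNIV g"
  shows "fun_calc h (\<lambda>t. f t + g t) = fun_calc h f + fun_calc h g"
proof (rule fun_calc_unique[OF h])
  fix e :: real assume "e > 0"
  then obtain p q where p: "approximates h f (fun_calc h f) (e/2) p"
      and q: "approximates h g (fun_calc h g) (e/2) q"
    using fun_calc_approx[OF h f, of "e/2"] fun_calc_approx[OF h g, of "e/2"] by auto
  have "norm ((fun_calc h f - poly_eval p h) + (fun_calc h g - poly_eval q h)) \<le> e/2 + e/2"
    using p q by (intro norm_triangle_mono) (auto simp: approximates_def)
  moreover have "\<bar>(f t - poly p t) + (g t - poly q t)\<bar> \<le> e/2 + e/2"
    if "complex_of_real t \<in> spectrum h" for t
    using p q that by (intro abs_triangle_ineq[THEN order_trans] add_mono) (auto simp: approximates_def)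
  ultimately have "approximates h (\<lambda>t. f t + g t) (fun_calc h f + fun_calc h g) e (p + q)"
    by (auto simp: approximates_def poly_eval_add algebra_simps)
  then show "\<exists>p. approximates h (\<lambda>t. f t + g t) (fun_calc h f + fun_calc h g) e p" by blast
qed

lemma fun_calc_mult:
  fixes h :: "'a::cstar_algebra"
  assumes h: "cstar h = h" and f: "continuous_on UNIV f" and g: "continuous_on UNIV g"
  shows "fun_calc h (\<lambda>t. f t * g t) = fun_calc h f * fun_calc h g"
proof (rule fun_calc_unique[OF h])
  fix e :: real assume e: "e > 0"
  have "bounded (f ` {- norm h..norm h})" "bounded (g ` {- norm h..norm h})"
    by (intro compact_imp_bounded compact_continuous_image continuous_on_subset[OF f]
        continuous_on_subset[OF g]; simp)+
  then obtain K1 K2 where K12: "\<forall>t\<in>{- norm h..norm h}. \<bar>f t\<bar> \<le> K1" "\<forall>t\<in>{- norm h..norm h}. \<bar>g t\<bar> \<le> K2"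
    by (auto simp: bounded_iff)
  have K: "\<bar>f t\<bar> \<le> K1" "\<bar>g t\<bar> \<le> K2" if "complex_of_real t \<in> spectrum h" for t
  proof -
    have "t \<in> {- norm h..norm h}" using that spectrum_norm_bound[of h] by auto
    then show "\<bar>f t\<bar> \<le> K1" "\<bar>g t\<bar> \<le> K2" using K12 by blast+
  qed
  define L where "L = max (max K1 K2) (max (norm (fun_calc h f)) (norm (fun_calc h g))) + 1"
  have L1: "L \<ge> 1" by (auto simp: L_def le_max_iff_disj)
  have L: "K1 + 1 \<le> L" "K2 + 1 \<le> L" "norm (fun_calc h f) + 1 \<le> L" "norm (fun_calc h g) + 1 \<le> L"
    by (auto simp: L_def)
  define d where "d = min 1 (e / (2 * L))"
  have d: "d > 0" "d \<le> 1" using e L1 by (auto simp: d_def)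
  have "d * (2 * L) \<le> e / (2 * L) * (2 * L)" using L1 by (intro mult_right_mono) (auto simp: d_def)
  then have dL: "d * L + L * d \<le> e" using L1 by (simp add: algebra_simps)
  obtain p q where p: "approximates h f (fun_calc h f) d p"
      and q: "approximates h g (fun_calc h g) d q"
    using fun_calc_approx[OF h f d(1)] fun_calc_approx[OF h g d(1)] by auto
  have "approximates h (\<lambda>t. f t * g t) (fun_calc h f * fun_calc h g) e (p * q)"
    unfolding approximates_def
  proof (intro conjI allI impI)
    fix t assume t: "complex_of_real t \<in> spectrum h"
    have pt: "\<bar>f t - poly p t\<bar> \<le> d" and qt: "\<bar>g t - poly q t\<bar> \<le> d"
      using p q t by (auto simp: approximates_def)
    have "f t * g t - poly (p * q) t = (f t - poly p t) * g t + poly p t * (g t - poly q t)"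
      by (simp add: algebra_simps)
    also have "\<bar>\<dots>\<bar> \<le> \<bar>f t - poly p t\<bar> * \<bar>g t\<bar> + \<bar>poly p t\<bar> * \<bar>g t - poly q t\<bar>"
      by (rule order_trans[OF abs_triangle_ineq]) (simp add: abs_mult)
    also have "\<dots> \<le> d * L + L * d"
      using pt qt K[OF t] d L by (intro add_mono mult_mono) auto
    finally show "\<bar>f t * g t - poly (p * q) t\<bar> \<le> e" using dL by linarith
  next
    have pt: "norm (fun_calc h f - poly_eval p h) \<le> d" and qt: "norm (fun_calc h g - poly_eval q h) \<le> d"
      using p q by (auto simp: approximates_def)
    have np: "norm (poly_eval p h) \<le> L"
      using norm_triangle_ineq2[of "poly_eval p h" "fun_calc h f"] pt d L
      by (simp add: norm_minus_commute)
    have "fun_calc h f * fun_calc h g - poly_eval (p * q) h =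
        (fun_calc h f - poly_eval p h) * fun_calc h g + poly_eval p h * (fun_calc h g - poly_eval q h)"
      by (simp add: algebra_simps poly_eval_mult)
    also have "norm \<dots> \<le> norm (fun_calc h f - poly_eval p h) * norm (fun_calc h g)
        + norm (poly_eval p h) * norm (fun_calc h g - poly_eval q h)"
      by (intro norm_triangle_mono norm_mult_ineq)
    also have "\<dots> \<le> d * L + L * d"
      using pt qt np d L L1 by (intro add_mono mult_mono) auto
    finally show "norm (fun_calc h f * fun_calc h g - poly_eval (p * q) h) \<le> e" using dL by linarith
  qed
  then show "\<exists>p. approximates h (\<lambda>t. f t * g t) (fun_calc h f * fun_calc h g) e p" by blast
qed

lemma fun_calc_scale:
  fixes h :: "'a::cstar_algebra"
  assumes "cstar h = h" "continuous_on UNIV f"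
  shows "fun_calc h (\<lambda>t. c * f t) = c *\<^sub>R fun_calc h f"
  using fun_calc_mult[OF assms(1) continuous_on_const assms(2), of c] by (simp add: fun_calc_const[OF assms(1)])

lemma fun_calc_diff:
  fixes h :: "'a::cstar_algebra"
  assumes "cstar h = h" "continuous_on UNIV f" "continuous_on UNIV g"
  shows "fun_calc h (\<lambda>t. f t - g t) = fun_calc h f - fun_calc h g"
  using fun_calc_add[OF assms(1,2), of "\<lambda>t. (-1) * g t"] fun_calc_scale[OF assms(1,3), of "-1"] assms(3)
  by (simp add: continuous_on_minus)

text \<open>Together with the norm estimate, this is what allows functions such as \<open>\<lambda>t. sqrt \<bar>t\<bar>\<close> to serve as
  the square root of an element with nonnegative spectrum.\<close>

lemma fun_calc_cong:
  fixes h :: "'a::cstar_algebra"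
  assumes "cstar h = h" "continuous_on UNIV f" "continuous_on UNIV g"
    and "\<And>t. complex_of_real t \<in> spectrum h \<Longrightarrow> f t = g t"
  shows "fun_calc h f = fun_calc h g"
proof -
  have "norm (fun_calc h (\<lambda>t. f t - g t)) \<le> 0"
    by (rule norm_fun_calc) (use assms in \<open>auto intro!: continuous_intros\<close>)
  then show ?thesis using fun_calc_diff[OF assms(1-3)] by simp
qed

lemma fun_calc_commute:
  fixes h :: "'a::cstar_algebra"
  assumes h: "cstar h = h" and f: "continuous_on UNIV f" and x: "x * h = h * x"
  shows "x * fun_calc h f = fun_calc h f * x"
proof -
  have "norm (x * fun_calc h f - fun_calc h f * x) \<le> 0"
  proof (rule field_le_epsilon)
    fix e :: real assume e: "e > 0"
    define d where "d = e / (2 * (norm x + 1))"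
    have nx: "norm x + 1 > 0" by (simp add: add_nonneg_pos)
    have d: "d > 0" using e nx by (simp add: d_def)
    have dx: "2 * (norm x * d) \<le> e"
    proof -
      have "2 * (norm x * d) \<le> 2 * ((norm x + 1) * d)" using d by (intro mult_left_mono mult_right_mono) auto
      also have "\<dots> = e" using nx by (simp add: d_def field_simps)
      finally show ?thesis .
    qed
    obtain p where p: "approximates h f (fun_calc h f) d p" using fun_calc_approx[OF h f d] by blast
    let ?r = "fun_calc h f - poly_eval p h"
    have "x * fun_calc h f - fun_calc h f * x = x * ?r - ?r * x"
      using poly_eval_commute[OF x, of p] by (simp add: algebra_simps)
    also have "norm \<dots> \<le> norm x * norm ?r + norm ?r * norm x"
      by (rule order_trans[OF norm_triangle_ineq4]) (intro add_mono norm_mult_ineq)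
    also have "\<dots> \<le> norm x * d + d * norm x"
      using p by (intro add_mono mult_left_mono mult_right_mono) (auto simp: approximates_def)
    finally show "norm (x * fun_calc h f - fun_calc h f * x) \<le> 0 + e" using dx by (simp add: mult.commute)
  qed
  then show ?thesis by simp
qed

lemma cstar_fun_calc:
  fixes h :: "'a::cstar_algebra"
  assumes h: "cstar h = h" and f: "continuous_on UNIV f"
  shows "cstar (fun_calc h f) = fun_calc h f"
proof (rule fun_calc_unique[OF h, symmetric])
  fix e :: real assume "e > 0"
  then obtain p where p: "approximates h f (fun_calc h f) e p" using fun_calc_approx[OF h f] by blast
  have "cstar (fun_calc h f) - poly_eval p h = cstar (fun_calc h f - poly_eval p h)"
    by (simp add: cstar_diff cstar_poly_eval[OF h])
  then have "approximates h f (cstar (fun_calc h f)) e p" using p by (simp add: approximates_def)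
  then show "\<exists>p. approximates h f (cstar (fun_calc h f)) e p" by blast
qed

lemma fun_calc_mult_commute:
  fixes h :: "'a::cstar_algebra"
  assumes "cstar h = h" "continuous_on UNIV f" "continuous_on UNIV g"
  shows "fun_calc h f * fun_calc h g = fun_calc h g * fun_calc h f"
  using fun_calc_mult[OF assms] fun_calc_mult[OF assms(1,3,2)] by (simp add: mult.commute)

lemma fun_calc_sum:
  fixes h :: "'a::cstar_algebra"
  assumes h: "cstar h = h" and "finite I" and "\<And>i. i \<in> I \<Longrightarrow> continuous_on UNIV (f i)"
  shows "fun_calc h (\<lambda>t. \<Sum>i\<in>I. f i t) = (\<Sum>i\<in>I. fun_calc h (f i))"
  using assms(2,3)
proof (induction I rule: finite_induct)
  case empty
  then show ?case using fun_calc_const[OF h, of 0] by simp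
next
  case (insert i I)
  then show ?case by (simp add: fun_calc_add[OF h] continuous_on_sum)
qed

section \<open>Positive elements\<close>

definition positive :: "'a::cstar_algebra \<Rightarrow> bool" where
  "positive x \<longleftrightarrow> cstar x = x \<and> spectrum x \<subseteq> complex_of_real ` {0..}"

lemma positive_selfadjoint: "positive x \<Longrightarrow> cstar x = x"
  by (simp add: positive_def)

lemma positive_spectrum: "positive x \<Longrightarrow> complex_of_real t \<in> spectrum x \<Longrightarrow> 0 \<le> t"
  by (auto simp: positive_def)

lemma positiveI:
  assumes "cstar x = x" "\<And>t. complex_of_real t \<in> spectrum x \<Longrightarrow> 0 \<le> t"
  shows "positive x"
  using assms selfadjoint_spectrum_real[OF assms(1)] unfolding positive_def by (force elim: Reals_cases)

text \<open>Positivity of a self-adjoint \<open>x\<close> amounts to \<open>norm (t - x) \<le> t\<close> for some \<open>t\<close>, equivalently for every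
  \<open>t \<ge> norm x\<close>.  In this form it passes to sums.\<close>

lemma positiveI_norm:
  assumes x: "cstar x = x" and n: "norm (t *\<^sub>R 1 - x) \<le> t" shows "positive x"
proof (rule positiveI[OF x])
  fix s assume s: "complex_of_real s \<in> spectrum x"
  have "of_real (t - s) \<in> spectrum (t *\<^sub>R 1 - x)"
    using s spectrum_shift[of "of_real (t - s)" "- x" "of_real t"] spectrum_uminus[of "- of_real s" x]
    by (simp add: scaleR_scaleC)
  then have "\<bar>t - s\<bar> \<le> norm (t *\<^sub>R 1 - x)"
    using spectrum_norm_bound[of "t *\<^sub>R 1 - x"] by (auto simp flip: of_real_diff)
  with n show "0 \<le> s" by linarith
qed

lemma positive_norm_le:
  assumes x: "positive x" and n: "norm x \<le> t" shows "norm (t *\<^sub>R 1 - x) \<le> t"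
proof (rule norm_le_from_spectrum)
  have t0: "0 \<le> t" using n norm_ge_zero order_trans by blast
  then show "0 \<le> t" .
  show "cstar (t *\<^sub>R 1 - x) = t *\<^sub>R 1 - x" using x by (simp add: cstar_simps positive_selfadjoint)
  show "spectrum (t *\<^sub>R 1 - x) \<subseteq> cball 0 t"
  proof
    fix l assume "l \<in> spectrum (t *\<^sub>R 1 - x)"
    then have l: "of_real t - l \<in> spectrum x"
      using spectrum_shift[of l "- x" "of_real t"] spectrum_uminus[of "l - of_real t" x]
      by (simp add: scaleR_scaleC)
    then obtain s where s: "of_real t - l = of_real s" "0 \<le> s"
      using x by (auto simp: positive_def)
    have "s \<le> norm x" using l s spectrum_norm_bound[of x] by auto
    moreover have "l = of_real (t - s)" using s(1) by (simp add: algebra_simps)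
    ultimately show "l \<in> cball 0 t" using s(2) n by (simp del: of_real_diff)
  qed
qed

lemma positive_add:
  assumes "positive x" "positive y" shows "positive (x + y)"
proof (rule positiveI_norm)
  show "cstar (x + y) = x + y" using assms by (simp add: cstar_add positive_selfadjoint)
  have "norm ((norm x *\<^sub>R 1 - x) + (norm y *\<^sub>R 1 - y)) \<le> norm x + norm y"
    using assms by (intro norm_triangle_mono positive_norm_le) auto
  then show "norm ((norm x + norm y) *\<^sub>R 1 - (x + y)) \<le> norm x + norm y"
    by (simp add: scaleR_add_left algebra_simps)
qed

lemma positive_scaleR:
  assumes "positive x" "0 \<le> c" shows "positive (c *\<^sub>R x)"
proof (cases "c = 0")
  case True then show ?thesis by (auto simp: positive_def)
next
  case False
  have "0 \<le> t" if "complex_of_real t \<in> spectrum (c *\<^sub>R x)" for t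
  proof -
    have "complex_of_real (t / c) \<in> spectrum x"
      using that False spectrum_scale[of "of_real c" "of_real t" x] by (simp add: scaleR_scaleC)
    from positive_spectrum[OF assms(1) this] show ?thesis using False assms(2)
      by (simp add: zero_le_divide_iff)
  qed
  then show ?thesis using assms by (intro positiveI) (auto simp: cstar_simps positive_selfadjoint)
qed

text \<open>With \<open>m\<^sup>2 = t\<close>, one has \<open>t - s\<^sup>2 = (m - s) (m + s)\<close>, so \<open>m\<close> or \<open>- m\<close> lies in the real spectrum of \<open>s\<close>.\<close>

lemma positive_square:
  assumes s: "cstar s = s" shows "positive (s * s)"
proof (rule positiveI)
  fix t assume t: "complex_of_real t \<in> spectrum (s * s)"
  define m where "m = csqrt (of_real t)"
  have m: "m * m = of_real t" by (simp add: m_def power2_eq_square[symmetric])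
  have "of_real t *\<^sub>C 1 - s * s = (m *\<^sub>C 1 - s) * (m *\<^sub>C 1 + s)"
    by (simp add: m[symmetric] algebra_simps scaleC_algebra scaleC_scaleC)
  then have "m *\<^sub>C 1 - s \<notin> invertibles \<or> m *\<^sub>C 1 + s \<notin> invertibles"
    using t invertible_mult by (metis (no_types, lifting) not_in_spectrum_iff)
  moreover have "m *\<^sub>C 1 + s = - ((- m) *\<^sub>C 1 - s)" by simp
  ultimately have "m \<in> spectrum s \<or> - m \<in> spectrum s"
    by (metis not_in_spectrum_iff invertible_minus_iff)
  then have "m \<in> \<real>" using selfadjoint_spectrum_real[OF s] by (metis Reals_minus_iff)
  then obtain r where "m = of_real r" by (auto elim: Reals_cases)
  then have "of_real (r * r) = complex_of_real t" using m by simp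
  then have "t = r * r" by (simp only: of_real_eq_iff)
  then show "0 \<le> t" by simp
qed (simp add: cstar_mult s)

lemma positive_fun_calc:
  assumes h: "cstar h = h" and f: "continuous_on UNIV f" and "\<And>t. 0 \<le> f t"
  shows "positive (fun_calc h f)"
proof -
  have c: "continuous_on UNIV (\<lambda>t. sqrt (f t))" by (intro continuous_intros f)
  have "fun_calc h f = fun_calc h (\<lambda>t. sqrt (f t) * sqrt (f t))"
    by (simp add: assms(3))
  also have "\<dots> = fun_calc h (\<lambda>t. sqrt (f t)) * fun_calc h (\<lambda>t. sqrt (f t))"
    by (rule fun_calc_mult[OF h c c])
  finally show ?thesis using positive_square[OF cstar_fun_calc[OF h c]] by simp
qed

lemma positive_sqrt:
  assumes x: "positive x"
  obtains s where "positive s" "s * s = x"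
proof -
  note sa = positive_selfadjoint[OF x]
  have c: "continuous_on UNIV (\<lambda>t. sqrt \<bar>t\<bar>)" by (intro continuous_intros)
  let ?s = "fun_calc x (\<lambda>t. sqrt \<bar>t\<bar>)"
  have "?s * ?s = fun_calc x (\<lambda>t. sqrt \<bar>t\<bar> * sqrt \<bar>t\<bar>)"
    by (rule fun_calc_mult[OF sa c c, symmetric])
  also have "\<dots> = fun_calc x (\<lambda>t. t)"
    using positive_spectrum[OF x] by (intro fun_calc_cong[OF sa] continuous_intros) auto
  finally have "?s * ?s = x" by (simp add: fun_calc_id[OF sa])
  moreover have "positive ?s" by (rule positive_fun_calc[OF sa c]) simp
  ultimately show ?thesis using that by blast
qed

definition pos_part :: "'a::cstar_algebra \<Rightarrow> 'a" where
  "pos_part h = fun_calc h (\<lambda>t. max t 0)"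

definition neg_part :: "'a::cstar_algebra \<Rightarrow> 'a" where
  "neg_part h = fun_calc h (\<lambda>t. max (- t) 0)"

lemma pos_neg_part:
  assumes h: "cstar h = h"
  shows "positive (pos_part h)" "positive (neg_part h)" "pos_part h - neg_part h = h"
    "pos_part h * neg_part h = 0" "neg_part h * pos_part h = 0"
proof -
  have c: "continuous_on UNIV (\<lambda>t::real. max t 0)" "continuous_on UNIV (\<lambda>t::real. max (- t) 0)"
    by (intro continuous_intros)+
  show "positive (pos_part h)" "positive (neg_part h)"
    unfolding pos_part_def neg_part_def by (rule positive_fun_calc[OF h]; use c in simp)+
  have "(\<lambda>t::real. max t 0 - max (- t) 0) = (\<lambda>t. t)" by (auto simp: max_def)
  then show "pos_part h - neg_part h = h"
    using fun_calc_diff[OF h c] by (simp add: pos_part_def neg_part_def fun_calc_id[OF h])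
  have "(\<lambda>t::real. max t 0 * max (- t) 0) = (\<lambda>t. 0)" by (auto simp: max_def)
  then show "pos_part h * neg_part h = 0"
    using fun_calc_mult[OF h c] by (simp add: pos_part_def neg_part_def fun_calc_const[OF h])
  then show "neg_part h * pos_part h = 0"
    using fun_calc_mult_commute[OF h c] by (simp add: pos_part_def neg_part_def)
qed

text \<open>Kaplansky's argument.  Let \<open>b\<close> be the negative part of \<open>w\<^sup>* w\<close> and \<open>c = w b\<close>.  Then \<open>c\<^sup>* c = - b\<^sup>3\<close>
  is negative, while \<open>c\<^sup>* c + c c\<^sup>*\<close> is a sum of squares of self-adjoint elements; hence \<open>c c\<^sup>*\<close> is
  positive.  But \<open>c\<^sup>* c\<close> and \<open>c c\<^sup>*\<close> have the same nonzero spectrum.\<close>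

lemma positive_cstar_mult: "positive (cstar w * w)"
proof -
  define a b c where "a = pos_part (cstar w * w)" and "b = neg_part (cstar w * w)" and "c = w * b"
  have sa: "cstar (cstar w * w) = cstar w * w" by (simp add: cstar_simps)
  have pa: "positive a" and pb: "positive b" and d: "a - b = cstar w * w"
    and ab: "a * b = 0" "b * a = 0"
    using pos_neg_part[OF sa] by (simp_all add: a_def b_def)
  have sb: "cstar b = b" using pb by (rule positive_selfadjoint)
  have "cstar c * c = b * (cstar w * w) * b" by (simp add: c_def cstar_mult sb mult.assoc)
  also have "\<dots> = b * a * b - b * b * b" by (simp add: d[symmetric] algebra_simps)
  finally have cc: "cstar c * c = - (b * b * b)" using ab by simp
  have pb3: "positive (b * b * b)"
  proof -
    obtain s where s: "positive s" "s * s = b" using pb by (rule positive_sqrt)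
    have "b * b * b = (s * b) * (b * s)" by (simp add: s(2)[symmetric] mult.assoc)
    moreover have "s * b = b * s" by (simp add: s(2)[symmetric] mult.assoc)
    ultimately have "b * b * b = (s * b) * (s * b)" by simp
    moreover have "cstar (s * b) = s * b"
      using \<open>s * b = b * s\<close> by (simp add: cstar_mult positive_selfadjoint[OF s(1)] sb)
    ultimately show ?thesis by (metis positive_square)
  qed
  define k l where "k = real_part c" and "l = imag_part c"
  have kl: "cstar k = k" "cstar l = l" "c = k + \<i> *\<^sub>C l"
    by (simp_all add: k_def l_def) (rule real_imag_part)
  have ccs: "cstar c = k - \<i> *\<^sub>C l" using kl by (simp add: cstar_simps)
  have "cstar c * c + c * cstar c = 2 *\<^sub>R (k * k + l * l)"
    unfolding ccs unfolding kl(3)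
    by (simp add: algebra_simps scaleC_algebra scaleC_scaleC scaleR_2)
  then have "c * cstar c = 2 *\<^sub>R (k * k + l * l) + b * b * b" using cc by (simp add: algebra_simps)
  moreover have "positive (2 *\<^sub>R (k * k + l * l) + b * b * b)"
    by (intro positive_add positive_scaleR positive_square kl pb3) simp
  ultimately have pcc: "positive (c * cstar c)" by simp
  have "spectrum (b * b * b) \<subseteq> {0}"
  proof
    fix m assume m: "m \<in> spectrum (b * b * b)"
    then have nm: "- m \<in> spectrum (cstar c * c)" by (simp add: cc spectrum_uminus)
    obtain t where t: "m = of_real t" "0 \<le> t" using m pb3 by (auto simp: positive_def)
    show "m \<in> {0}"
    proof (rule ccontr)
      assume "m \<notin> {0}"
      then have "- m \<in> spectrum (c * cstar c)"
        using nm nonzero_spectrum_swap[of "- m" "cstar c" c] by simp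
      then have "complex_of_real (- t) \<in> spectrum (c * cstar c)" using t by simp
      from positive_spectrum[OF pcc this] t \<open>m \<notin> {0}\<close> show False by simp
    qed
  qed
  then have "b * b * b = 0" using positive_selfadjoint[OF pb3] by (rule selfadjoint_eq_0[rotated])
  then have "cstar (b * b) * (b * b) = 0" by (simp add: cstar_mult sb mult.assoc[symmetric])
  then have "cstar b * b = 0" by (simp only: cstar_mult_eq_0 sb)
  then have "b = 0" by (simp only: cstar_mult_eq_0)
  with d pa show ?thesis by simp
qed

lemma positive_shift_invertible:
  assumes "positive x" "0 < c" shows "x + c *\<^sub>R 1 \<in> invertibles"
proof -
  have "complex_of_real (- c) \<notin> spectrum x" using positive_spectrum[OF assms(1), of "- c"] assms(2) by auto
  moreover have "complex_of_real (- c) *\<^sub>C 1 - x = - (x + c *\<^sub>R 1)" by (simp add: scaleR_scaleC)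
  ultimately show ?thesis by (metis not_in_spectrum_iff invertible_minus_iff)
qed

lemma positive_shift_sqrt:
  assumes x: "positive x" and c: "0 < c"
  obtains p q where "p * p = x + c *\<^sub>R 1" "p * q = 1" "q * p = 1" "cstar p = p" "cstar q = q"
proof -
  have "positive (x + c *\<^sub>R 1)"
    using positive_add[OF x positive_scaleR[OF positive_square[of 1], of c]] c by simp
  then obtain p where p: "positive p" "p * p = x + c *\<^sub>R 1" by (rule positive_sqrt)
  have "p \<in> invertibles"
    using positive_shift_invertible[OF x c] invertible_commuting_factor[of p p] p by simp
  then obtain q where q: "p * q = 1" "q * p = 1" by (rule invertiblesE)
  show ?thesis
    using that[OF p(2) q positive_selfadjoint[OF p(1)] cstar_inverse_selfadjoint[OF q positive_selfadjoint[OF p(1)]]] .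
qed

text \<open>With \<open>p\<^sup>2 = y + c\<close>, the element equals \<open>p (p\<^sup>-\<^sup>1 x p\<^sup>-\<^sup>1 + i) p\<close>, and \<open>- i\<close> is not in the real
  spectrum of \<open>p\<^sup>-\<^sup>1 x p\<^sup>-\<^sup>1\<close>.\<close>

lemma positive_imaginary_part_invertible:
  assumes x: "cstar x = x" and y: "positive y" and c: "0 < c"
  shows "x + \<i> *\<^sub>C (y + c *\<^sub>R 1) \<in> invertibles"
proof -
  obtain p q where p: "p * p = y + c *\<^sub>R 1" "p * q = 1" "q * p = 1" "cstar p = p" "cstar q = q"
    using positive_shift_sqrt[OF y c] .
  have pi: "p \<in> invertibles" using p by (auto intro: invertiblesI)
  have "cstar (q * x * q) = q * x * q" by (simp add: cstar_mult p x mult.assoc)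
  then have "q * x * q + \<i> *\<^sub>C 1 \<in> invertibles" by (rule selfadjoint_nonreal_invertible) simp
  then have "p * (q * x * q + \<i> *\<^sub>C 1) * p \<in> invertibles" using pi by (intro invertible_mult)
  moreover have "p * (q * x * q + \<i> *\<^sub>C 1) * p = (p * q) * x * (q * p) + \<i> *\<^sub>C (p * p)"
    by (simp add: algebra_simps scaleC_algebra)
  ultimately show ?thesis using p by simp
qed

section \<open>Spectra of products determine the element\<close>

text \<open>For invertible \<open>z\<close>, the hypothesis says that \<open>z - a v\<close> is invertible exactly if \<open>z - b v\<close> is.  Now
  \<open>l - (a - b) x\<close> has the form \<open>z - b (- x)\<close> with \<open>z = l - a x\<close>, while \<open>z - a (- x) = l\<close> is invertible; and
  its negative is \<open>z - a (- x)\<close> with \<open>z = - l - b x\<close>.\<close>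

lemma uniqueness_spectrum_difference:
  fixes a b x :: "'a::complex_banach_algebra"
  assumes eq: "\<And>z. spectrum (a * z) = spectrum (b * z)"
    and l: "l \<noteq> 0" "l \<in> spectrum ((a - b) * x)"
  shows "l \<in> spectrum (a * x)" "- l \<in> spectrum (a * x)"
proof -
  have shift: "z - a * v \<in> invertibles \<longleftrightarrow> z - b * v \<in> invertibles" if z: "z \<in> invertibles" for z v
  proof -
    obtain w where w: "z * w = 1" "w * z = 1" using z by (rule invertiblesE)
    have "z - c * v \<in> invertibles \<longleftrightarrow> 1 \<notin> spectrum (c * (v * w))" for c
    proof -
      have "z - c * v = (1 - c * (v * w)) * z" using w by (simp add: algebra_simps)
      then show ?thesis by (simp add: invertible_mult_right_iff[OF z] not_in_spectrum_iff)
    qed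
    then show ?thesis by (simp add: eq)
  qed
  have l1: "k *\<^sub>C (1::'a) \<in> invertibles" if "k \<noteq> 0" for k using that by (simp add: invertible_scaleC_iff)
  have d: "l *\<^sub>C 1 - (a - b) * x = (l *\<^sub>C 1 - a * x) - b * (- x)" by (simp add: algebra_simps)
  have nd: "- (l *\<^sub>C 1 - (a - b) * x) = ((- l) *\<^sub>C 1 - b * x) - a * (- x)" by (simp add: algebra_simps)
  show "l \<in> spectrum (a * x)"
  proof (rule ccontr)
    assume "l \<notin> spectrum (a * x)"
    then have z: "l *\<^sub>C 1 - a * x \<in> invertibles" by (simp add: not_in_spectrum_iff)
    have "(l *\<^sub>C 1 - a * x) - a * (- x) \<in> invertibles" using l1[OF l(1)] by simp
    then have "l *\<^sub>C 1 - (a - b) * x \<in> invertibles" unfolding d shift[OF z] .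
    then show False using l(2) by (simp add: spectrum_def)
  qed
  show "- l \<in> spectrum (a * x)"
  proof (rule ccontr)
    assume "- l \<notin> spectrum (a * x)"
    then have z: "(- l) *\<^sub>C 1 - b * x \<in> invertibles" unfolding eq not_in_spectrum_iff .
    have "((- l) *\<^sub>C 1 - b * x) - b * (- x) \<in> invertibles" using l1[of "- l"] l(1) by simp
    then have "- (l *\<^sub>C 1 - (a - b) * x) \<in> invertibles" unfolding nd shift[OF z] .
    then show False using l(2) unfolding invertible_minus_iff by (simp add: spectrum_def)
  qed
qed

text \<open>For self-adjoint \<open>p\<close> and nonreal \<open>n\<close>, put \<open>u = p + n\<close> and \<open>x = a\<^sup>* u\<^sup>-\<^sup>1\<close>.  If \<open>l\<close> and \<open>- l\<close> were both in
  the spectrum of \<open>a x\<close>, neither \<open>u - a a\<^sup>* / l\<close> nor \<open>u + a a\<^sup>* / l\<close> would be invertible; but for one of the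
  two the imaginary part is definite, being the sum of \<open>Im n\<close> and a multiple of the positive element
  \<open>a a\<^sup>*\<close> of the same sign.  By the preceding lemma the spectrum of \<open>(a - b) x\<close> is contained in \<open>{0}\<close>, which
  says that \<open>l (p + n) - e\<close> is invertible for \<open>e = (a - b) a\<^sup>*\<close>, \<open>l \<noteq> 0\<close> and all such \<open>p\<close> and \<open>n\<close>.
  The choice \<open>p = Re e\<close> shows that \<open>Im e\<close> has no nonzero spectral value, and then \<open>p = 0\<close> shows the same
  for \<open>e\<close>.\<close>

lemma uniqueness_mult_cstar:
  fixes a b :: "'a::cstar_algebra"
  assumes eq: "\<And>z. spectrum (a * z) = spectrum (b * z)"
  shows "(a - b) * cstar a = 0"
proof -
  define e where "e = (a - b) * cstar a"
  have paa: "positive (a * cstar a)" using positive_cstar_mult[of "cstar a"] by (simp add: cstar_cstar)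
  have key: "l *\<^sub>C (p + n *\<^sub>C 1) - e \<in> invertibles"
    if p: "cstar p = p" and n: "Im n \<noteq> 0" and l: "l \<noteq> 0" for p n l
  proof -
    let ?u = "p + n *\<^sub>C 1"
    have u: "?u \<in> invertibles" using p n by (rule selfadjoint_nonreal_invertible)
    then obtain v where v: "?u * v = 1" "v * ?u = 1" by (rule invertiblesE)
    have as_u: "k \<in> spectrum (c * v) \<longleftrightarrow> k *\<^sub>C ?u - c \<notin> invertibles" for k c
    proof -
      have "k *\<^sub>C ?u - c = (k *\<^sub>C 1 - c * v) * ?u"
        using v(2) by (simp add: left_diff_distrib mult.assoc mult_scaleC_left del: distrib_left)
      then show ?thesis by (simp add: spectrum_def invertible_mult_right_iff[OF u])
    qed
    have half: "m *\<^sub>C ?u - a * cstar a \<in> invertibles" if m: "m \<noteq> 0" "Im n * Im (1 / m) \<le> 0" for m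
    proof -
      define k where "k = 1 / m"
      define r where "r = a * cstar a"
      have sr: "cstar r = r" using positive_selfadjoint[OF paa] by (simp add: r_def)
      \<comment> \<open>the factor \<open>sg\<close> turns a negative definite imaginary part into a positive one\<close>
      define sg where "sg = sgn (Im n)"
      have sg: "sg \<noteq> 0" "sg * Im n = \<bar>Im n\<bar>" using n by (auto simp: sg_def sgn_if)
      have "sg * (- Im k) \<ge> 0" using m(2) n by (auto simp: k_def sg_def sgn_if mult_le_0_iff)
      then have py: "positive ((sg * (- Im k)) *\<^sub>R r)" using paa unfolding r_def by (intro positive_scaleR)
      let ?x = "sg *\<^sub>R (p + Re n *\<^sub>R 1 - Re k *\<^sub>R r)"
      have "?x + \<i> *\<^sub>C ((sg * (- Im k)) *\<^sub>R r + \<bar>Im n\<bar> *\<^sub>R 1) \<in> invertibles"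
        using n by (intro positive_imaginary_part_invertible py) (simp_all add: cstar_simps p sr)
      also have "?x + \<i> *\<^sub>C ((sg * (- Im k)) *\<^sub>R r + \<bar>Im n\<bar> *\<^sub>R 1) = of_real sg *\<^sub>C (?u - k *\<^sub>C r)"
      proof -
        have nn: "n = of_real (Re n) + \<i> * of_real (Im n)" and kk: "k = of_real (Re k) + \<i> * of_real (Im k)"
          by (simp_all add: complex_eq)
        have "of_real sg *\<^sub>C (?u - k *\<^sub>C r) = of_real sg *\<^sub>C (p + (of_real (Re n) + \<i> * of_real (Im n)) *\<^sub>C 1
            - (of_real (Re k) + \<i> * of_real (Im k)) *\<^sub>C r)"
          using nn kk by simp
        then show ?thesis
          by (simp add: sg(2)[symmetric] scaleR_scaleC scaleC_algebra scaleC_scaleC algebra_simps)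
      qed
      finally have "?u - k *\<^sub>C r \<in> invertibles" using sg(1) by (simp add: invertible_scaleC_iff)
      moreover have "m *\<^sub>C ?u - r = m *\<^sub>C (?u - k *\<^sub>C r)"
        using m(1) by (simp add: k_def complex_scale.scale_right_diff_distrib scaleC_scaleC)
      ultimately show ?thesis using m(1) by (simp add: invertible_scaleC_iff r_def)
    qed
    have "\<not> (l \<in> spectrum (a * (cstar a * v)) \<and> - l \<in> spectrum (a * (cstar a * v)))"
    proof (cases "Im n * Im (1 / l) \<le> 0")
      case True
      then show ?thesis using half[OF l] as_u[of l "a * cstar a"] by (simp add: mult.assoc)
    next
      case False
      then have "Im n * Im (1 / (- l)) \<le> 0" by simp
      then show ?thesis using half[of "- l"] l as_u[of "- l" "a * cstar a"] by (simp add: mult.assoc)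
    qed
    then have "l \<notin> spectrum ((a - b) * (cstar a * v))"
      using uniqueness_spectrum_difference[OF eq l] by blast
    then show ?thesis using as_u[of l e] by (simp add: e_def mult.assoc)
  qed
  have im0: "imag_part e = 0"
  proof (rule selfadjoint_eq_0)
    show "spectrum (imag_part e) \<subseteq> {0}"
    proof
      fix m assume m: "m \<in> spectrum (imag_part e)"
      show "m \<in> {0}"
      proof (rule ccontr)
        assume "m \<notin> {0}"
        obtain t where t: "m = of_real t"
          using selfadjoint_spectrum_real[OF selfadjoint_parts(2) m] by (auto elim: Reals_cases)
        have "1 *\<^sub>C (real_part e + (\<i> * m) *\<^sub>C 1) - e \<in> invertibles"
          using t \<open>m \<notin> {0}\<close> by (intro key) auto
        moreover have "1 *\<^sub>C (real_part e + (\<i> * m) *\<^sub>C 1) - e = \<i> *\<^sub>C (m *\<^sub>C 1 - imag_part e)"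
          by (subst (2) real_imag_part[of e]) (simp add: scaleC_algebra scaleC_scaleC)
        ultimately show False using m by (simp add: invertible_scaleC_iff spectrum_def)
      qed
    qed
  qed simp
  have "e = real_part e" using real_imag_part[of e] im0 by simp
  then have se: "cstar e = e" by (metis selfadjoint_parts(1))
  have "e = 0"
  proof (rule selfadjoint_eq_0[OF se])
    show "spectrum e \<subseteq> {0}"
    proof
      fix m assume m: "m \<in> spectrum e"
      show "m \<in> {0}"
      proof (rule ccontr)
        assume "m \<notin> {0}"
        then have "(- \<i> * m) *\<^sub>C (0 + \<i> *\<^sub>C 1) - e \<in> invertibles" by (intro key) auto
        moreover have "(- \<i> * m) * \<i> = m" by (simp add: algebra_simps)
        ultimately show False using m by (simp only: add_0 scaleC_scaleC) (simp add: spectrum_def)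
      qed
    qed
  qed
  then show ?thesis by (simp add: e_def)
qed

text \<open>Exchanging the roles of \<open>a\<close> and \<open>b\<close> gives \<open>(b - a) b\<^sup>* = 0\<close> as well, so \<open>(a - b) (a - b)\<^sup>* = 0\<close>.\<close>

theorem element_determined_by_spectra:
  fixes a b :: "'a::cstar_algebra"
  assumes eq: "\<And>z. spectrum (a * z) = spectrum (b * z)"
  shows "a = b"
proof -
  have "(a - b) * cstar a = 0" using uniqueness_mult_cstar[OF eq] .
  moreover have "(b - a) * cstar b = 0" using uniqueness_mult_cstar[OF eq[symmetric]] .
  ultimately have "(a - b) * cstar (a - b) = 0" by (simp add: cstar_diff algebra_simps)
  then show ?thesis by (simp add: mult_cstar_eq_0)
qed

section \<open>Maps preserving the spectra of products\<close>

text \<open>Tent functions at the integers form a partition of unity: each is the difference of two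
  consecutive translates of a ramp, so their sum telescopes.\<close>

lemma tent_sum:
  fixes s :: real
  assumes "0 \<le> s" "s \<le> real N"
  shows "(\<Sum>i\<le>N. max 0 (1 - \<bar>s - real i\<bar>)) = 1"
proof -
  define r :: "real \<Rightarrow> real" where "r x = max 0 (min 1 x)" for x
  have "max 0 (1 - \<bar>s - real i\<bar>) = r (s - real i + 1) - r (s - real (Suc i) + 1)" for i
    by (auto simp: r_def max_def min_def)
  then have "(\<Sum>i\<le>N. max 0 (1 - \<bar>s - real i\<bar>)) =
      (\<Sum>i<Suc N. r (s - real i + 1) - r (s - real (Suc i) + 1))"
    by (simp only: lessThan_Suc_atMost)
  also have "\<dots> = r (s + 1) - r (s - real N)"
    by (subst sum_lessThan_telescope') simp
  also have "\<dots> = 1" using assms by (simp add: r_def)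
  finally show ?thesis .
qed

lemma le_zero_if_le_multiples:
  fixes a C :: real
  assumes C: "0 \<le> C" and small: "\<And>e. e > 0 \<Longrightarrow> a \<le> C * e"
  shows "a \<le> 0"
proof (rule field_le_epsilon)
  fix e :: real assume e: "e > 0"
  have "a \<le> C * (e / (C + 1))" using e C by (intro small) simp
  also have "\<dots> \<le> e" using e C by (simp add: field_simps)
  finally show "a \<le> 0 + e" by simp
qed

locale product_spectrum_map =
  fixes \<phi> :: "'a::cstar_algebra \<Rightarrow> 'b::complex_banach_algebra"
  assumes surj: "surj \<phi>"
    and spectrum_1: "spectrum (\<phi> x) = spectrum x"
    and spectrum_2: "spectrum (\<phi> x * \<phi> y) = spectrum (x * y)"
    and spectrum_3: "spectrum (\<phi> x * \<phi> y * \<phi> z) = spectrum (x * y * z)"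
begin

text \<open>The product \<open>\<phi> x * \<phi> y\<close> has a preimage, and its products with all \<open>z\<close> have the same spectra as those
  of \<open>x * y\<close>.\<close>

lemma phi_mult: "\<phi> (x * y) = \<phi> x * \<phi> y"
proof -
  obtain t where t: "\<phi> t = \<phi> x * \<phi> y" using surj by (metis surjD)
  have "spectrum (t * z) = spectrum ((x * y) * z)" for z
    by (metis spectrum_2 spectrum_3 t)
  then have "t = x * y" by (rule element_determined_by_spectra)
  with t show ?thesis by simp
qed

lemma phi_inject: "\<phi> x = \<phi> y \<longleftrightarrow> x = y"
proof
  assume "\<phi> x = \<phi> y"
  then have "spectrum (x * z) = spectrum (y * z)" for z by (metis spectrum_2)
  then show "x = y" by (rule element_determined_by_spectra)
qed simp

lemma phi_0 [simp]: "\<phi> 0 = 0"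
proof -
  obtain t where t: "\<phi> t = 0" using surj by (metis surjD)
  have "spectrum (t * z) = spectrum (0 * z)" for z
    using spectrum_2[of t z] by (simp add: t)
  then have "t = 0" by (rule element_determined_by_spectra)
  with t show ?thesis by simp
qed

lemma phi_scale: "\<phi> (c *\<^sub>C x) = c *\<^sub>C \<phi> x"
proof (cases "c = 0")
  case False
  obtain t where t: "\<phi> t = c *\<^sub>C \<phi> x" using surj by (metis surjD)
  have "spectrum (t * z) = spectrum ((c *\<^sub>C x) * z)" for z
  proof -
    have "spectrum (t * z) = spectrum (c *\<^sub>C (\<phi> x * \<phi> z))"
      using spectrum_2[of t z] by (simp add: t mult_scaleC_left)
    also have "\<dots> = spectrum (c *\<^sub>C (x * z))"
      using spectrum_2[of x z] by (auto simp: spectrum_scale[OF False])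
    finally show ?thesis by (simp add: mult_scaleC_left)
  qed
  then have "t = c *\<^sub>C x" by (rule element_determined_by_spectra)
  with t show ?thesis by simp
qed simp

lemma phi_minus: "\<phi> (- x) = - \<phi> x"
  using phi_scale[of "-1" x] by simp

lemma phi_1 [simp]: "\<phi> 1 = 1"
proof -
  obtain t where t: "\<phi> t = 1" using surj by (metis surjD)
  then show ?thesis by (metis phi_mult mult_1_left mult_1_right)
qed

lemma phi_commute: "x * y = y * x \<Longrightarrow> \<phi> x * \<phi> y = \<phi> y * \<phi> x"
  by (metis phi_mult)

lemma spectrum_phi_shift: "spectrum (\<phi> x + c *\<^sub>C 1) = spectrum (x + c *\<^sub>C 1)"
  by (auto simp: spectrum_shift spectrum_1)

section \<open>Additivity on multiples of a self-adjoint element\<close>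

text \<open>On the support of \<open>g\<close>, the function \<open>k\<close> agrees with the identity, and it stays within \<open>e\<close> of \<open>c\<close>
  everywhere.  So \<open>\<phi> y\<close> may be replaced by \<open>D1 - D2\<close> in front of \<open>\<phi> G\<close>, and both \<open>D1\<close> and \<open>D2\<close> have the
  spectrum of \<open>z (K - c)\<close>.  Everything in sight commutes, which makes spectral radii multiply.\<close>

lemma one_plus_local:
  assumes h: "cstar h = h" and y: "\<phi> y = \<phi> (1 + z *\<^sub>C h) - 1 - z *\<^sub>C \<phi> h"
    and comm: "\<And>g. g * h = h * g \<Longrightarrow> g * y = y * g"
    and e: "e > 0" and g: "continuous_on UNIV g" "\<And>t. \<bar>g t\<bar> \<le> 1" "\<And>t. \<bar>t - c\<bar> \<ge> e \<Longrightarrow> g t = 0"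
  shows "spectrum (fun_calc h g * (y * cstar y)) \<subseteq> cball 0 (2 * cmod z * e * norm y)"
proof -
  define k where "k t = max (c - e) (min (c + e) t)" for t
  define G K where "G = fun_calc h g" and "K = fun_calc h k"
  have ck: "continuous_on UNIV k" unfolding k_def by (intro continuous_intros)
  have sG: "cstar G = G" and sK: "cstar K = K"
    unfolding G_def K_def by (rule cstar_fun_calc[OF h]; fact)+
  have Gh: "h * G = G * h" unfolding G_def by (rule fun_calc_commute[OF h g(1)]) simp
  have Kh: "h * K = K * h" unfolding K_def by (rule fun_calc_commute[OF h ck]) simp
  have KG: "K * G = G * K" unfolding G_def K_def by (rule fun_calc_mult_commute[OF h ck g(1)])
  have "K * G = fun_calc h (\<lambda>t. k t * g t)"
    unfolding G_def K_def by (rule fun_calc_mult[OF h ck g(1), symmetric])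
  also have "(\<lambda>t. k t * g t) = (\<lambda>t. t * g t)"
  proof
    fix t show "k t * g t = t * g t"
      using g(3)[of t] by (cases "\<bar>t - c\<bar> \<ge> e") (auto simp: k_def max_def min_def)
  qed
  also have "fun_calc h (\<lambda>t. t * g t) = h * G"
    using fun_calc_mult[OF h continuous_on_id g(1)] by (simp add: G_def fun_calc_id[OF h])
  finally have KGh: "K * G = h * G" .
  have Ky: "K * y = y * K" and Gy: "G * y = y * G" using comm Gh Kh by metis+
  have Kys: "K * cstar y = cstar y * K" using arg_cong[OF Ky, of cstar] by (simp add: cstar_mult sK)
  define D1 D2 where "D1 = \<phi> (1 + z *\<^sub>C K) + (- (1 + z * of_real c)) *\<^sub>C 1"
    and "D2 = \<phi> (z *\<^sub>C K) + (- (z * of_real c)) *\<^sub>C 1"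
  have nK: "norm (K - c *\<^sub>R 1) \<le> e"
  proof -
    have "K - c *\<^sub>R 1 = fun_calc h (\<lambda>t. k t - c)"
      by (simp add: K_def fun_calc_diff[OF h ck continuous_on_const] fun_calc_const[OF h])
    also have "norm \<dots> \<le> e"
      by (rule norm_fun_calc[OF h]) (use ck e in \<open>auto simp: k_def intro!: continuous_intros\<close>)
    finally show ?thesis .
  qed
  have nzK: "norm (z *\<^sub>C (K - c *\<^sub>R 1)) \<le> cmod z * e"
    using nK by (simp add: norm_scaleC mult_left_mono)
  have e1: "(1 + z *\<^sub>C K) + (- (1 + z * of_real c)) *\<^sub>C 1 = z *\<^sub>C (K - c *\<^sub>R 1)"
    and e2: "z *\<^sub>C K + (- (z * of_real c)) *\<^sub>C 1 = z *\<^sub>C (K - c *\<^sub>R 1)"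
    by (simp_all add: scaleR_scaleC scaleC_algebra scaleC_scaleC)
  have D1: "spectrum D1 \<subseteq> cball 0 (cmod z * e)" and D2: "spectrum D2 \<subseteq> cball 0 (cmod z * e)"
    unfolding D1_def D2_def spectrum_phi_shift e1 e2
    using spectrum_norm_bound[of "z *\<^sub>C (K - c *\<^sub>R 1)"] nzK by auto
  have D2': "spectrum (- D2) \<subseteq> cball 0 (cmod z * e)"
    using D2 by (auto simp: spectrum_uminus subset_iff dest: spec[of _ "- _"])
  have "\<phi> (1 + z *\<^sub>C K) * \<phi> (z *\<^sub>C K) = \<phi> (z *\<^sub>C K) * \<phi> (1 + z *\<^sub>C K)"
    by (rule phi_commute) (simp add: algebra_simps)
  then have "D1 * (- D2) = - D2 * D1"
    by (simp add: D1_def D2_def algebra_simps scaleC_algebra scaleC_scaleC)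
  then have D: "spectrum (D1 + - D2) \<subseteq> cball 0 (cmod z * e + cmod z * e)"
    using D1 D2' e by (intro spectrum_commuting_add) auto
  have D_eq: "D1 + - D2 = \<phi> (1 + z *\<^sub>C K) - 1 - z *\<^sub>C \<phi> K"
    by (simp add: D1_def D2_def phi_scale scaleC_algebra)
  have DG: "(D1 + - D2) * \<phi> G = \<phi> y * \<phi> G"
  proof -
    have "(1 + z *\<^sub>C K) * G = (1 + z *\<^sub>C h) * G"
      by (simp add: distrib_right mult_scaleC_left KGh)
    then have "\<phi> (1 + z *\<^sub>C K) * \<phi> G = \<phi> (1 + z *\<^sub>C h) * \<phi> G" by (metis phi_mult)
    moreover have "\<phi> K * \<phi> G = \<phi> h * \<phi> G" using KGh by (metis phi_mult)
    ultimately show ?thesis unfolding D_eq y by (simp add: left_diff_distrib mult_scaleC_left)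
  qed
  have KGy: "K * (G * cstar y) = (G * cstar y) * K"
    using KG Kys by (metis mult.assoc)
  have comm1: "\<phi> (1 + z *\<^sub>C K) * \<phi> (G * cstar y) = \<phi> (G * cstar y) * \<phi> (1 + z *\<^sub>C K)"
    by (rule phi_commute) (simp add: KGy distrib_left distrib_right mult_scaleC_left mult_scaleC_right)
  have comm2: "\<phi> K * \<phi> (G * cstar y) = \<phi> (G * cstar y) * \<phi> K"
    by (rule phi_commute[OF KGy])
  have commD: "(D1 + - D2) * \<phi> (G * cstar y) = \<phi> (G * cstar y) * (D1 + - D2)"
    unfolding D_eq
    by (simp add: comm1 comm2 left_diff_distrib right_diff_distrib mult_scaleC_left mult_scaleC_right)
  have nGy: "norm (G * cstar y) \<le> norm y"
  proof -
    have "norm G \<le> 1" unfolding G_def by (rule norm_fun_calc[OF h g(1)]) (rule g(2))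
    then have "norm G * norm (cstar y) \<le> 1 * norm (cstar y)" by (rule mult_right_mono) simp
    then show ?thesis using norm_mult_ineq[of G "cstar y"] by simp
  qed
  have "spectrum (\<phi> (G * cstar y)) \<subseteq> cball 0 (norm y)"
    unfolding spectrum_1 using spectrum_norm_bound[of "G * cstar y"] nGy by auto
  from spectrum_commuting_mult[OF D this commD]
  have "spectrum ((D1 + - D2) * \<phi> (G * cstar y)) \<subseteq> cball 0 ((cmod z * e + cmod z * e) * norm y)"
    using e by simp
  also have "(D1 + - D2) * \<phi> (G * cstar y) = \<phi> (y * G * cstar y)"
    by (simp only: phi_mult mult.assoc[symmetric] DG)
  also have "y * G * cstar y = G * (y * cstar y)" by (simp add: Gy[symmetric] mult.assoc)
  finally show ?thesis unfolding spectrum_1 by (simp add: G_def algebra_simps)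
qed

text \<open>Tents of width \<open>e\<close> at the points \<open>i e - norm h\<close> cover the spectrum.  Those with even index are
  pairwise orthogonal, and so are those with odd index; the local estimate thus passes to the sums over
  each class without growing with the number of tents.\<close>

lemma phi_one_plus:
  assumes h: "cstar h = h"
  shows "\<phi> (1 + z *\<^sub>C h) = 1 + z *\<^sub>C \<phi> h"
proof -
  obtain y where y: "\<phi> y = \<phi> (1 + z *\<^sub>C h) - 1 - z *\<^sub>C \<phi> h" using surj by (metis surjD)
  have comm: "g * y = y * g" if g: "g * h = h * g" for g
  proof -
    have "\<phi> g * \<phi> h = \<phi> h * \<phi> g" by (rule phi_commute[OF g])
    moreover have "\<phi> g * \<phi> (1 + z *\<^sub>C h) = \<phi> (1 + z *\<^sub>C h) * \<phi> g"
      by (rule phi_commute) (simp add: g distrib_left distrib_right mult_scaleC_left mult_scaleC_right)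
    ultimately have "\<phi> g * \<phi> y = \<phi> y * \<phi> g"
      unfolding y by (simp add: left_diff_distrib right_diff_distrib mult_scaleC_left mult_scaleC_right)
    then show ?thesis by (simp add: phi_mult[symmetric] phi_inject)
  qed
  define w where "w = y * cstar y"
  have sw: "cstar w = w" by (simp add: w_def cstar_mult cstar_cstar)
  define C where "C = 4 * cmod z * norm y"
  have small: "norm w \<le> C * e" if e: "e > 0" for e
  proof -
    obtain N where N: "2 * norm h / e \<le> real N" using real_arch_simple by blast
    define g where "g i t = max 0 (1 - \<bar>(t + norm h) / e - real i\<bar>)" for i t
    define G where "G i = fun_calc h (g i)" for i
    have cg: "continuous_on UNIV (g i)" for i unfolding g_def using e by (intro continuous_intros) auto
    have sG: "cstar (G i) = G i" for i unfolding G_def by (rule cstar_fun_calc[OF h cg])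
    have hG: "G i * h = h * G i" for i
      unfolding G_def using fun_calc_commute[OF h cg, of h] by simp
    have Gy: "G i * y = y * G i" for i using comm hG by metis
    have Gys: "G i * cstar y = cstar y * G i" for i
      using arg_cong[OF Gy, of cstar] by (simp add: cstar_mult sG)
    have Gw: "G i * w = w * G i" for i unfolding w_def by (metis Gy Gys mult.assoc)
    have local: "spectrum (G i * w) \<subseteq> cball 0 (2 * cmod z * e * norm y)" for i
      unfolding G_def w_def
    proof (rule one_plus_local[OF h y comm e cg, where c = "real i * e - norm h"])
      show "\<bar>g i t\<bar> \<le> 1" for t by (simp add: g_def max_def)
      show "g i t = 0" if "e \<le> \<bar>t - (real i * e - norm h)\<bar>" for t
      proof -
        have "(t + norm h) / e - real i = (t - (real i * e - norm h)) / e"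
          using e by (simp add: field_simps)
        then have "1 \<le> \<bar>(t + norm h) / e - real i\<bar>" using that e by (simp add: abs_divide)
        then show ?thesis by (simp add: g_def)
      qed
    qed
    have orth: "G i * G j = 0" if "i \<noteq> j" "even i \<longleftrightarrow> even j" for i j
    proof -
      have ij: "i + 2 \<le> j \<or> j + 2 \<le> i"
        using that by (metis Suc_leI add_2_eq_Suc' even_Suc le_neq_implies_less linorder_neqE_nat)
      have "G i * G j = fun_calc h (\<lambda>t. g i t * g j t)"
        unfolding G_def by (rule fun_calc_mult[OF h cg cg, symmetric])
      also have "(\<lambda>t. g i t * g j t) = (\<lambda>t. 0)"
      proof
        fix t
        have "real i + 2 \<le> real j \<or> real j + 2 \<le> real i" using ij by linarith
        then have "1 \<le> \<bar>(t + norm h) / e - real i\<bar> \<or> 1 \<le> \<bar>(t + norm h) / e - real j\<bar>" by linarith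
        then show "g i t * g j t = 0" by (auto simp: g_def)
      qed
      finally show ?thesis by (simp add: fun_calc_const[OF h])
    qed
    have part: "norm (\<Sum>i\<in>I. G i * w) \<le> 2 * cmod z * e * norm y"
      if I: "finite I" "\<And>i j. i \<in> I \<Longrightarrow> j \<in> I \<Longrightarrow> even i \<longleftrightarrow> even j" for I
    proof (rule norm_le_from_spectrum)
      have "cstar (\<Sum>i\<in>I. G i * w) = (\<Sum>i\<in>I. cstar (G i * w))"
        using I(1) by (induction I rule: finite_induct) (simp_all add: cstar_add)
      then show "cstar (\<Sum>i\<in>I. G i * w) = (\<Sum>i\<in>I. G i * w)" by (simp add: cstar_mult sG sw Gw)
      show "spectrum (\<Sum>i\<in>I. G i * w) \<subseteq> cball 0 (2 * cmod z * e * norm y)"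
      proof (rule spectrum_orthogonal_family[OF I(1) local])
        fix i j assume "i \<in> I" "j \<in> I" "i \<noteq> j"
        then have "G i * G j = 0" using orth I(2) by blast
        moreover have "(G i * w) * (G j * w) = (G i * G j) * w * w"
          by (simp add: mult.assoc) (metis Gw mult.assoc)
        ultimately show "(G i * w) * (G j * w) = 0" by simp
      qed (use e in simp)
    qed (use e in simp)
    have "(\<Sum>i\<le>N. G i) = fun_calc h (\<lambda>t. \<Sum>i\<le>N. g i t)"
      unfolding G_def by (rule fun_calc_sum[OF h _ cg, symmetric]) simp
    also have "\<dots> = fun_calc h (\<lambda>t. 1)"
    proof (rule fun_calc_cong[OF h])
      show "continuous_on UNIV (\<lambda>t. \<Sum>i\<le>N. g i t)" by (intro continuous_on_sum cg)
      fix t assume t: "complex_of_real t \<in> spectrum h"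
      have "\<bar>t\<bar> \<le> norm h" using t spectrum_norm_bound[of h] by auto
      then have t: "0 \<le> t + norm h" "t + norm h \<le> 2 * norm h" by auto
      have "0 \<le> (t + norm h) / e" using t e by simp
      moreover have "(t + norm h) / e \<le> real N"
        using divide_right_mono[OF t(2), of e] e N by linarith
      ultimately show "(\<Sum>i\<le>N. g i t) = 1" unfolding g_def by (rule tent_sum)
    qed simp
    finally have "(\<Sum>i\<le>N. G i) = 1" by (simp add: fun_calc_const[OF h])
    then have "w = (\<Sum>i\<le>N. G i * w)" by (simp add: sum_distrib_right[symmetric])
    also have "\<dots> = (\<Sum>i | i \<le> N \<and> even i. G i * w) + (\<Sum>i | i \<le> N \<and> odd i. G i * w)"
      by (subst sum.union_disjoint[symmetric]) (auto intro!: sum.cong)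
    also have "norm \<dots> \<le> 2 * cmod z * e * norm y + 2 * cmod z * e * norm y"
      by (intro norm_triangle_mono part) auto
    finally show ?thesis by (simp add: C_def algebra_simps)
  qed
  have "0 \<le> C" by (simp add: C_def)
  from le_zero_if_le_multiples[OF this small] have "norm w \<le> 0" .
  then have "y = 0" by (simp add: w_def mult_cstar_eq_0)
  with y show ?thesis by (simp add: algebra_simps)
qed

section \<open>Linearity\<close>

lemma phi_shift_selfadjoint:
  assumes "cstar a = a" "l \<noteq> 0" shows "\<phi> (a + l *\<^sub>C 1) = \<phi> a + l *\<^sub>C 1"
proof -
  have "a + l *\<^sub>C 1 = l *\<^sub>C (1 + (1 / l) *\<^sub>C a)" using assms(2) by (simp add: scaleC_algebra scaleC_scaleC)
  then have "\<phi> (a + l *\<^sub>C 1) = l *\<^sub>C (1 + (1 / l) *\<^sub>C \<phi> a)"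
    by (simp only: phi_scale phi_one_plus[OF assms(1)])
  then show ?thesis using assms(2) by (simp add: scaleC_algebra scaleC_scaleC)
qed

text \<open>\<open>p\<^sup>2 + z b = p (1 + z (p\<^sup>-\<^sup>1 b p\<^sup>-\<^sup>1)) p\<close>, and \<open>p\<^sup>-\<^sup>1 b p\<^sup>-\<^sup>1\<close> is self-adjoint.\<close>

lemma phi_add_square:
  assumes p: "p * q = 1" "q * p = 1" "cstar p = p" "cstar q = q" and b: "cstar b = b"
  shows "\<phi> (p * p + z *\<^sub>C b) = \<phi> (p * p) + z *\<^sub>C \<phi> b"
proof -
  have s: "cstar (q * b * q) = q * b * q" by (simp add: cstar_mult p b mult.assoc)
  have pq: "p * (q * b * q) * p = b"
  proof -
    have "p * (q * b * q) * p = (p * q) * b * (q * p)" by (simp add: mult.assoc)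
    then show ?thesis by (simp add: p)
  qed
  have "p * p + z *\<^sub>C b = p * (1 + z *\<^sub>C (q * b * q)) * p"
    using pq by (simp add: distrib_left distrib_right mult_scaleC_left mult_scaleC_right)
  then have "\<phi> (p * p + z *\<^sub>C b) = \<phi> p * (1 + z *\<^sub>C \<phi> (q * b * q)) * \<phi> p"
    by (simp add: phi_mult[of "_ * _" p] phi_mult[of p "1 + _"] phi_one_plus[OF s])
  also have "\<dots> = \<phi> p * \<phi> p + z *\<^sub>C (\<phi> p * \<phi> (q * b * q) * \<phi> p)"
    by (simp add: distrib_left distrib_right mult_scaleC_left mult_scaleC_right)
  also have "\<phi> p * \<phi> (q * b * q) * \<phi> p = \<phi> b" by (simp add: phi_mult[symmetric] pq)
  finally show ?thesis by (simp add: phi_mult)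
qed

lemma phi_add_positive:
  assumes "positive a" "c > 0" "cstar b = b"
  shows "\<phi> ((a + c *\<^sub>R 1) + z *\<^sub>C b) = \<phi> (a + c *\<^sub>R 1) + z *\<^sub>C \<phi> b"
proof -
  obtain p q where p: "p * p = a + c *\<^sub>R 1" "p * q = 1" "q * p = 1" "cstar p = p" "cstar q = q"
    using positive_shift_sqrt[OF assms(1,2)] .
  from phi_add_square[OF p(2-5) assms(3), of z] show ?thesis by (simp add: p(1))
qed

text \<open>Move a scalar \<open>l > norm a\<close> from \<open>b\<close> to \<open>a\<close> to make the first summand positive and invertible.\<close>

lemma phi_add_selfadjoint:
  assumes a: "cstar a = a" and b: "cstar b = b"
  shows "\<phi> (a + b) = \<phi> a + \<phi> b"
proof -
  define l where "l = norm a + 1"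
  have l: "l > 0" by (simp add: l_def add_nonneg_pos)
  have pos: "positive (a + norm a *\<^sub>R 1)"
  proof (rule positiveI_norm)
    show "cstar (a + norm a *\<^sub>R 1) = a + norm a *\<^sub>R 1" by (simp add: cstar_simps a)
    have "norm (norm a *\<^sub>R 1 - a) \<le> norm a + norm a"
      using norm_triangle_ineq4[of "norm a *\<^sub>R 1" a] by simp
    moreover have "(2 * norm a) *\<^sub>R 1 - (a + norm a *\<^sub>R 1) = norm a *\<^sub>R 1 - a"
      unfolding mult_2 scaleR_add_left by simp
    ultimately show "norm ((2 * norm a) *\<^sub>R 1 - (a + norm a *\<^sub>R 1)) \<le> 2 * norm a" by (simp only: mult_2)
  qed
  have la: "(a + norm a *\<^sub>R 1) + 1 *\<^sub>R 1 = a + of_real l *\<^sub>C 1"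
    by (simp add: l_def scaleR_scaleC scaleC_algebra)
  have sb: "cstar (b + (- of_real l) *\<^sub>C 1) = b + (- of_real l) *\<^sub>C 1" by (simp add: cstar_simps b)
  have "a + b = ((a + norm a *\<^sub>R 1) + 1 *\<^sub>R 1) + 1 *\<^sub>C (b + (- of_real l) *\<^sub>C 1)"
    unfolding la by simp
  then have "\<phi> (a + b) = \<phi> (((a + norm a *\<^sub>R 1) + 1 *\<^sub>R 1) + 1 *\<^sub>C (b + (- of_real l) *\<^sub>C 1))"
    by (rule arg_cong)
  also have "\<dots> = \<phi> ((a + norm a *\<^sub>R 1) + 1 *\<^sub>R 1) + 1 *\<^sub>C \<phi> (b + (- of_real l) *\<^sub>C 1)"
    by (rule phi_add_positive[OF pos _ sb]) simp
  also have "\<dots> = \<phi> a + \<phi> b"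
    unfolding la using l phi_shift_selfadjoint[OF a, of "of_real l"] phi_shift_selfadjoint[OF b, of "- of_real l"]
    by simp
  finally show ?thesis .
qed

text \<open>The complex-linear extension of the restriction of \<open>\<phi>\<close> to self-adjoint elements.\<close>

definition linear_ext :: "'a \<Rightarrow> 'b" where
  "linear_ext x = \<phi> (real_part x) + \<i> *\<^sub>C \<phi> (imag_part x)"

lemma linear_ext_add: "linear_ext (x + y) = linear_ext x + linear_ext y"
proof -
  have "real_part (x + y) = real_part x + real_part y" "imag_part (x + y) = imag_part x + imag_part y"
    by (simp_all add: real_part_def imag_part_def cstar_add scaleC_algebra scaleR_add_right algebra_simps)
  then show ?thesis by (simp add: linear_ext_def phi_add_selfadjoint scaleC_algebra)
qed

lemma linear_ext_scale: "linear_ext (c *\<^sub>C x) = c *\<^sub>C linear_ext x"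
proof -
  obtain r s where c: "c = of_real r + \<i> * of_real s" using complex_eq by blast
  define a b where "a = real_part x" and "b = imag_part x"
  have ab: "cstar a = a" "cstar b = b" "x = a + \<i> *\<^sub>C b"
    by (simp_all add: a_def b_def) (rule real_imag_part)
  have "c *\<^sub>C x = (r *\<^sub>R a + (- s) *\<^sub>R b) + \<i> *\<^sub>C (r *\<^sub>R b + s *\<^sub>R a)"
    by (simp add: ab(3) c scaleR_scaleC scaleC_algebra scaleC_scaleC algebra_simps)
  then have "real_part (c *\<^sub>C x) = r *\<^sub>R a + (- s) *\<^sub>R b" "imag_part (c *\<^sub>C x) = r *\<^sub>R b + s *\<^sub>R a"
    using parts_unique[of "r *\<^sub>R a + (- s) *\<^sub>R b" "r *\<^sub>R b + s *\<^sub>R a" "c *\<^sub>C x"]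
    by (simp_all add: cstar_simps ab(1,2))
  then have "linear_ext (c *\<^sub>C x) = \<phi> (r *\<^sub>R a) + \<phi> ((- s) *\<^sub>R b) + \<i> *\<^sub>C (\<phi> (r *\<^sub>R b) + \<phi> (s *\<^sub>R a))"
    unfolding linear_ext_def by (simp only: phi_add_selfadjoint cstar_scaleR ab(1,2))
  also have "\<dots> = c *\<^sub>C linear_ext x"
    by (simp add: linear_ext_def a_def[symmetric] b_def[symmetric] scaleR_scaleC phi_scale phi_minus c
        scaleC_algebra scaleC_scaleC algebra_simps)
  finally show ?thesis .
qed

text \<open>For \<open>k > 0\<close> let \<open>g = (a - k)\<^sub>+\<close> and \<open>c = (k - a)\<^sub>+\<close>, where \<open>a\<close> is the real part of \<open>x\<close>.  The element
  \<open>x + c\<close> has real part \<open>max a k\<close>, so \<open>\<phi> (x + c) = linear_ext x + \<phi> c\<close>.  Because \<open>c g = 0\<close>, multiplying by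
  \<open>\<phi> g\<close> yields \<open>\<phi> x \<phi> g = linear_ext x \<phi> g\<close>, that is \<open>y g = 0\<close>; let \<open>k\<close> tend to \<open>0\<close>.  The negative part of
  \<open>a\<close> is treated by starting from \<open>- x\<close>, which is the case \<open>s = - 1\<close>.\<close>

lemma kills_real_part:
  assumes y: "\<phi> y = \<phi> x - linear_ext x"
  shows "y * real_part x = 0"
proof -
  define a b where "a = real_part x" and "b = imag_part x"
  have ab: "cstar a = a" "cstar b = b" "x = a + \<i> *\<^sub>C b"
    by (simp_all add: a_def b_def) (rule real_imag_part)
  have half: "y * fun_calc a (\<lambda>t. max (s * t) 0) = 0" if s: "s = 1 \<or> s = -1" for s :: real
  proof -
    have small: "norm (y * fun_calc a (\<lambda>t. max (s * t) 0)) \<le> norm y * k" if k: "k > 0" for k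
    proof -
      define g c where "g = fun_calc a (\<lambda>t. max (s * t - k) 0)" and "c = fun_calc a (\<lambda>t. max (k - s * t) 0)"
      have cont: "continuous_on UNIV (\<lambda>t. max (s * t - k) 0)" "continuous_on UNIV (\<lambda>t. max (k - s * t) 0)"
        "continuous_on UNIV (\<lambda>t. max (s * t) 0)"
        by (intro continuous_intros)+
      have pg: "positive g" unfolding g_def by (rule positive_fun_calc[OF ab(1) cont(1)]) simp
      have sc: "cstar c = c" unfolding c_def by (rule cstar_fun_calc[OF ab(1) cont(2)])
      have "c * g = fun_calc a (\<lambda>t. max (k - s * t) 0 * max (s * t - k) 0)"
        unfolding g_def c_def by (rule fun_calc_mult[OF ab(1) cont(2,1), symmetric])
      also have "(\<lambda>t. max (k - s * t) 0 * max (s * t - k) 0) = (\<lambda>t. 0)" by (auto simp: max_def)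
      finally have cg: "c * g = 0" by (simp add: fun_calc_const[OF ab(1)])
      have "g - c = fun_calc a (\<lambda>t. max (s * t - k) 0 - max (k - s * t) 0)"
        unfolding g_def c_def by (rule fun_calc_diff[OF ab(1) cont(1,2), symmetric])
      also have "(\<lambda>t. max (s * t - k) 0 - max (k - s * t) 0) = (\<lambda>t. s * t - k)" by (auto simp: max_def)
      also have "fun_calc a \<dots> = s *\<^sub>R a - k *\<^sub>R 1"
        using fun_calc_diff[OF ab(1), of "\<lambda>t. s * t" "\<lambda>t. k"] fun_calc_scale[OF ab(1), of "\<lambda>t. t" s]
        by (simp add: fun_calc_id[OF ab(1)] fun_calc_const[OF ab(1)] continuous_on_mult_left)
      finally have gc: "g + k *\<^sub>R 1 = s *\<^sub>R a + c" by (simp add: algebra_simps)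
      define w where "w = s *\<^sub>R x + c"
      have "w = (g + k *\<^sub>R 1) + (\<i> * of_real s) *\<^sub>C b"
        unfolding gc by (simp add: w_def ab(3) scaleR_scaleC scaleC_algebra scaleC_scaleC mult.commute)
      then have "\<phi> w = \<phi> (s *\<^sub>R a + c) + (\<i> * of_real s) *\<^sub>C \<phi> b"
        using phi_add_positive[OF pg k ab(2)] by (simp add: gc)
      also have "\<phi> (s *\<^sub>R a + c) = of_real s *\<^sub>C \<phi> a + \<phi> c"
        by (simp add: phi_add_selfadjoint cstar_scaleR ab(1) sc) (simp add: scaleR_scaleC phi_scale)
      finally have phiw: "\<phi> w = of_real s *\<^sub>C linear_ext x + \<phi> c"
        by (simp add: linear_ext_def a_def b_def scaleC_algebra scaleC_scaleC mult.commute)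
      have "w * g = s *\<^sub>R (x * g)" by (simp add: w_def distrib_right cg)
      then have "of_real s *\<^sub>C (\<phi> x * \<phi> g) = \<phi> w * \<phi> g"
        by (simp add: phi_mult[symmetric] scaleR_scaleC phi_scale[symmetric])
      also have "\<dots> = of_real s *\<^sub>C (linear_ext x * \<phi> g)"
        using cg by (simp add: phiw distrib_right mult_scaleC_left phi_mult[symmetric])
      finally have "\<phi> x * \<phi> g = linear_ext x * \<phi> g" using s by auto
      then have "\<phi> (y * g) = \<phi> 0" by (simp add: phi_mult y left_diff_distrib)
      then have yg: "y * g = 0" by (simp only: phi_inject)
      have "fun_calc a (\<lambda>t. max (s * t) 0) - g = fun_calc a (\<lambda>t. max (s * t) 0 - max (s * t - k) 0)"
        unfolding g_def by (rule fun_calc_diff[OF ab(1) cont(3,1), symmetric])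
      also have "norm \<dots> \<le> k"
        using k by (intro norm_fun_calc[OF ab(1)] continuous_intros) (auto simp: max_def)
      finally have n: "norm (fun_calc a (\<lambda>t. max (s * t) 0) - g) \<le> k" .
      have "y * fun_calc a (\<lambda>t. max (s * t) 0) = y * (fun_calc a (\<lambda>t. max (s * t) 0) - g)"
        by (simp add: right_diff_distrib yg)
      also have "norm \<dots> \<le> norm y * norm (fun_calc a (\<lambda>t. max (s * t) 0) - g)" by (rule norm_mult_ineq)
      also have "\<dots> \<le> norm y * k" using n by (rule mult_left_mono) simp
      finally show ?thesis .
    qed
    have "norm (y * fun_calc a (\<lambda>t. max (s * t) 0)) \<le> 0"
      using norm_ge_zero[of y] small by (rule le_zero_if_le_multiples)
    then show ?thesis by simp
  qed
  have "y * pos_part a = 0" "y * neg_part a = 0"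
    using half[of 1] half[of "-1"] by (simp_all add: pos_part_def neg_part_def)
  then have "y * (pos_part a - neg_part a) = 0" by (simp add: right_diff_distrib)
  then show ?thesis by (simp add: pos_neg_part(3)[OF ab(1)] a_def[symmetric])
qed

text \<open>Let \<open>\<phi> y\<close> be the difference of the two sides.  The previous lemma, applied to \<open>x\<close> and to \<open>- i x\<close>, shows
  that \<open>y\<close> annihilates the real and the imaginary part of \<open>x\<close>.  Taking adjoints, both parts and \<open>x\<close> itself
  annihilate \<open>y\<^sup>*\<close>, so each term of \<open>\<phi> y \<phi> (y\<^sup>*)\<close> vanishes.\<close>

lemma phi_eq_linear_ext: "\<phi> x = linear_ext x"
proof -
  obtain y where y: "\<phi> y = \<phi> x - linear_ext x" using surj by (metis surjD)
  have re: "y * real_part x = 0" using y by (rule kills_real_part)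
  have "\<phi> ((- \<i>) *\<^sub>C y) = \<phi> ((- \<i>) *\<^sub>C x) - linear_ext ((- \<i>) *\<^sub>C x)"
    unfolding phi_scale linear_ext_scale y by (simp add: scaleC_algebra)
  from kills_real_part[OF this] have "((- \<i>) *\<^sub>C y) * real_part ((- \<i>) *\<^sub>C x) = 0" .
  moreover have "real_part ((- \<i>) *\<^sub>C x) = imag_part x"
    by (simp add: real_part_def imag_part_def cstar_simps scaleR_scaleC scaleC_algebra scaleC_scaleC)
  ultimately have "(- \<i>) *\<^sub>C (y * imag_part x) = 0" by (simp only: mult_scaleC_left)
  then have im: "y * imag_part x = 0" by (simp only: complex_scale.scale_eq_0_iff) simp
  have res: "real_part x * cstar y = 0" and ims: "imag_part x * cstar y = 0"
    using arg_cong[OF re, of cstar] arg_cong[OF im, of cstar] by (simp_all add: cstar_mult)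
  have "x * cstar y = (real_part x + \<i> *\<^sub>C imag_part x) * cstar y"
    using real_imag_part[of x] by simp
  then have xs: "x * cstar y = 0" by (simp add: distrib_right mult_scaleC_left res ims)
  have "\<phi> (y * cstar y) = \<phi> (x * cstar y) - (\<phi> (real_part x * cstar y) + \<i> *\<^sub>C \<phi> (imag_part x * cstar y))"
    unfolding phi_mult y linear_ext_def by (simp add: left_diff_distrib distrib_right mult_scaleC_left)
  then have "\<phi> (y * cstar y) = \<phi> 0" by (simp only: xs res ims) simp
  then have "y = 0" by (simp only: phi_inject mult_cstar_eq_0)
  with y show ?thesis by simp
qed

theorem phi_isomorphism: "algebra_isomorphism \<phi>"
  unfolding algebra_isomorphism_def
proof (intro conjI allI)
  show "Vector_Spaces.linear scaleC scaleC \<phi>"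
    unfolding Vector_Spaces.linear_iff
    by (simp add: vector_space_scaleC phi_scale) (simp add: phi_eq_linear_ext linear_ext_add)
  show "bij \<phi>" using surj by (auto simp: bij_def inj_def phi_inject)
qed (rule phi_mult)

end

section \<open>Algebra isomorphisms are continuous\<close>

text \<open>By Baire's theorem, the closure of \<open>{x. norm (f x) \<le> n}\<close> contains a ball for some \<open>n\<close>.  By
  linearity, elements of norm below \<open>r / 2 ^ k\<close> are then limits of elements with image of norm at most
  \<open>N / 2 ^ k\<close>; a series of successive approximations, whose images are summable, reaches \<open>x\<close> itself,
  and the closed graph identifies \<open>f x\<close> with the sum of the images.\<close>

theorem closed_graph:
  fixes f :: "'a::banach \<Rightarrow> 'b::banach"
  assumes lin: "linear f"
    and graph: "\<And>X x y. X \<longlonglongrightarrow> x \<Longrightarrow> (\<lambda>n. f (X n)) \<longlonglongrightarrow> y \<Longrightarrow> f x = y"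
  shows "bounded_linear f"
proof -
  define S where "S n = closure {x. norm (f x) \<le> real n}" for n
  have "\<exists>n. interior (S n) \<noteq> {}"
  proof (rule ccontr)
    assume "\<not> ?thesis"
    then have "euclidean interior_of (\<Union> (range S)) = {}"
      by (intro Baire_category_alt) (auto simp: completely_metrizable_space_euclidean S_def)
    moreover have "\<Union> (range S) = UNIV"
    proof -
      have "x \<in> \<Union> (range S)" for x
      proof -
        obtain n where "norm (f x) \<le> real n" using real_arch_simple by blast
        then have "x \<in> S n" unfolding S_def by (intro closure_subset[THEN subsetD]) simp
        then show ?thesis by blast
      qed
      then show ?thesis by blast
    qed
    ultimately show False by simp
  qed
  then obtain n x0 r where r: "r > 0" "ball x0 r \<subseteq> S n"
    by (metis all_not_in_conv mem_interior)
  define N where "N = 2 * real n + 1"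
  have N: "N > 0" by (simp add: N_def)
  have approx: "\<exists>v. norm (f v) \<le> N \<and> norm (u - v) < e" if u: "norm u < r" and e: "e > 0" for u e
  proof -
    have "x0 + u \<in> S n" "x0 \<in> S n" using u r by (auto simp: dist_norm)
    then obtain v w where v: "norm (f v) \<le> real n" "dist v (x0 + u) < e / 2"
        and w: "norm (f w) \<le> real n" "dist w x0 < e / 2"
      using e unfolding S_def closure_approachable by (metis (no_types, lifting) half_gt_zero mem_Collect_eq)
    have "norm (f v - f w) \<le> real n + real n" using v w by (intro order_trans[OF norm_triangle_ineq4] add_mono)
    then have "norm (f (v - w)) \<le> N" by (simp add: linear_diff[OF lin] N_def)
    moreover have "norm ((w - x0) - (v - (x0 + u))) < e / 2 + e / 2"
      using v(2) w(2) norm_triangle_ineq4[of "w - x0" "v - (x0 + u)"] unfolding dist_norm by linarith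
    then have "norm (u - (v - w)) < e" by (simp add: algebra_simps)
    ultimately show ?thesis by blast
  qed
  have step: "\<exists>v. norm (f v) \<le> N / 2 ^ k \<and> norm (u - v) < r / 2 ^ Suc k" if "norm u < r / 2 ^ k" for k u
  proof -
    from that have "norm ((2 ^ k) *\<^sub>R u) < r" by (simp add: field_simps)
    then obtain v where v: "norm (f v) \<le> N" "norm ((2 ^ k) *\<^sub>R u - v) < r / 2" using approx r by (metis half_gt_zero)
    let ?v = "(1 / 2 ^ k) *\<^sub>R v"
    have "norm (f ?v) \<le> N / 2 ^ k" using v(1) by (simp add: linear_scale[OF lin] divide_right_mono)
    moreover have "u - ?v = (1 / 2 ^ k) *\<^sub>R ((2 ^ k) *\<^sub>R u - v)" by (simp add: scaleR_diff_right)
    then have "norm (u - ?v) = norm ((2 ^ k) *\<^sub>R u - v) / 2 ^ k" by simp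
    then have "norm (u - ?v) < r / 2 ^ Suc k" using v(2) by (simp add: field_simps)
    ultimately show ?thesis by blast
  qed
  define V where "V k u = (SOME v. norm (f v) \<le> N / 2 ^ k \<and> norm (u - v) < r / 2 ^ Suc k)" for k u
  have V: "norm (f (V k u)) \<le> N / 2 ^ k \<and> norm (u - V k u) < r / 2 ^ Suc k"
    if "norm u < r / 2 ^ k" for k u
    unfolding V_def using step[OF that] by (rule someI_ex)
  have ball: "norm (f x) \<le> 2 * N" if x: "norm x < r" for x
  proof -
    define u where "u = rec_nat x (\<lambda>k w. w - V k w)"
    have u0: "u 0 = x" and uS: "\<And>k. u (Suc k) = u k - V k (u k)" by (simp_all add: u_def)
    have nu: "norm (u k) < r / 2 ^ k" for k
    proof (induction k)
      case 0
      then show ?case using x by (simp add: u0)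
    next
      case (Suc k)
      then show ?case using V unfolding uS by blast
    qed
    define v where "v k = V k (u k)" for k
    have nv: "norm (f (v k)) \<le> N / 2 ^ k" for k using V[OF nu] by (simp add: v_def)
    have geo: "(\<lambda>k. N / 2 ^ k) sums (2 * N)"
    proof -
      have "(\<lambda>k. (1 / 2) ^ k) sums (1 / (1 - 1 / 2 :: real))" by (rule geometric_sums) simp
      from sums_mult[OF this, of N] show ?thesis by (simp add: power_divide mult.commute)
    qed
    have sn: "summable (\<lambda>k. norm (f (v k)))"
      by (rule summable_comparison_test'[OF sums_summable[OF geo], where N = 0]) (simp add: nv)
    have s: "(\<lambda>k. f (v k)) sums (\<Sum>k. f (v k))"
      by (rule summable_sums[OF summable_norm_cancel[OF sn]])
    have X: "f (x - u m) = (\<Sum>k<m. f (v k))" for m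
    proof (induction m)
      case (Suc m)
      have "x - u (Suc m) = (x - u m) + v m" by (simp add: uS v_def)
      then show ?case by (simp only: linear_add[OF lin] Suc sum.lessThan_Suc)
    qed (simp add: u0 linear_0[OF lin])
    have "u \<longlonglongrightarrow> 0"
    proof (rule Lim_null_comparison)
      show "eventually (\<lambda>k. norm (u k) \<le> r * (1 / 2) ^ k) sequentially"
        using nu by (intro always_eventually allI) (simp add: power_one_over less_imp_le)
      have "(\<lambda>k. (1 / 2) ^ k :: real) \<longlonglongrightarrow> 0" by (rule LIMSEQ_realpow_zero) auto
      from tendsto_mult_right_zero[OF this] show "(\<lambda>k. r * (1 / 2) ^ k) \<longlonglongrightarrow> 0" .
    qed
    from tendsto_diff[OF tendsto_const this] have "(\<lambda>m. x - u m) \<longlonglongrightarrow> x" by simp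
    moreover have "(\<lambda>m. f (x - u m)) \<longlonglongrightarrow> (\<Sum>k. f (v k))" using s unfolding X sums_def .
    ultimately have "f x = (\<Sum>k. f (v k))" by (rule graph)
    also have "norm \<dots> \<le> (\<Sum>k. norm (f (v k)))" by (rule summable_norm[OF sn])
    also have "\<dots> \<le> (\<Sum>k. N / 2 ^ k)" by (rule suminf_le[OF nv sn sums_summable[OF geo]])
    also have "\<dots> = 2 * N" using geo by (rule sums_unique[symmetric])
    finally show ?thesis .
  qed
  have "norm (f x) \<le> norm x * (4 * N / r)" for x
  proof (cases "x = 0")
    case False
    define c where "c = r / (2 * norm x)"
    have c: "c > 0" using r False by (simp add: c_def)
    have "norm (c *\<^sub>R x) < r" using r False by (simp add: c_def)
    then have "norm (f (c *\<^sub>R x)) \<le> 2 * N" by (rule ball)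
    then have "c * norm (f x) \<le> 2 * N" using c by (simp add: linear_scale[OF lin])
    then have "norm (f x) \<le> 2 * N / c" using c by (simp add: field_simps)
    also have "\<dots> = norm x * (4 * N / r)" using r False by (simp add: c_def)
    finally show ?thesis .
  qed (simp add: linear_0[OF lin])
  then show ?thesis using lin by (intro bounded_linear_intro[where K = "4 * N / r"])
      (auto simp: linear_add linear_scale)
qed

lemma algebra_isomorphism_simps:
  assumes "algebra_isomorphism \<phi>"
  shows "\<phi> (x + y) = \<phi> x + \<phi> y" "\<phi> (c *\<^sub>C x) = c *\<^sub>C \<phi> x" "\<phi> (x * y) = \<phi> x * \<phi> y" "bij \<phi>"
  using assms unfolding algebra_isomorphism_def Vector_Spaces.linear_iff by auto

lemma algebra_isomorphism_linear:
  assumes "algebra_isomorphism \<phi>" shows "linear \<phi>"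
  using algebra_isomorphism_simps[OF assms] by (intro linearI) (simp_all add: scaleR_scaleC)

lemma algebra_isomorphism_1:
  assumes "algebra_isomorphism \<phi>" shows "\<phi> 1 = 1"
proof -
  obtain t where t: "\<phi> t = 1" using algebra_isomorphism_simps(4)[OF assms] by (metis bij_pointE)
  then show ?thesis using algebra_isomorphism_simps(3)[OF assms] by (metis mult_1_left mult_1_right)
qed

lemma algebra_isomorphism_spectrum:
  assumes iso: "algebra_isomorphism \<phi>" shows "spectrum (\<phi> x) = spectrum x"
proof -
  note simps = algebra_isomorphism_simps[OF iso]
  have inv: "\<phi> z \<in> invertibles \<longleftrightarrow> z \<in> invertibles" for z
  proof
    assume "z \<in> invertibles"
    then obtain w where "z * w = 1" "w * z = 1" by (rule invertiblesE)
    then show "\<phi> z \<in> invertibles"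
      by (intro invertiblesI[of _ "\<phi> w"]) (simp_all add: simps(3)[symmetric] algebra_isomorphism_1[OF iso])
  next
    assume "\<phi> z \<in> invertibles"
    then obtain w' where w': "\<phi> z * w' = 1" "w' * \<phi> z = 1" by (rule invertiblesE)
    obtain w where "w' = \<phi> w" using simps(4) by (metis bij_pointE)
    with w' have "\<phi> (z * w) = \<phi> 1" "\<phi> (w * z) = \<phi> 1"
      by (simp_all add: simps(3) algebra_isomorphism_1[OF iso])
    then show "z \<in> invertibles" using simps(4) by (intro invertiblesI[of z w]) (auto simp: bij_def inj_def)
  qed
  have "l *\<^sub>C 1 - \<phi> x = \<phi> (l *\<^sub>C 1 - x)" for l
    by (simp add: linear_diff[OF algebra_isomorphism_linear[OF iso]] simps algebra_isomorphism_1[OF iso])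
  then show ?thesis by (simp add: spectrum_def inv)
qed

text \<open>The C*-norm of \<open>x\<^sup>* x\<close> is its spectral radius, which an isomorphism preserves and a Banach algebra
  norm dominates.\<close>

lemma algebra_isomorphism_norm:
  fixes \<phi> :: "'a::cstar_algebra \<Rightarrow> 'b::complex_banach_algebra"
  assumes iso: "algebra_isomorphism \<phi>"
  shows "(norm x)\<^sup>2 \<le> norm (\<phi> (cstar x)) * norm (\<phi> x)"
proof -
  have "norm (cstar x * x) \<le> norm (\<phi> (cstar x * x))"
    using spectrum_norm_bound[of "\<phi> (cstar x * x)"] unfolding algebra_isomorphism_spectrum[OF iso]
    by (intro norm_le_from_spectrum) (simp_all add: cstar_simps)
  also have "\<dots> \<le> norm (\<phi> (cstar x)) * norm (\<phi> x)"
    unfolding algebra_isomorphism_simps(3)[OF iso] by (rule norm_mult_ineq)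
  finally show ?thesis by (simp add: norm_cstar_mult)
qed

text \<open>The involution, carried over to \<open>B\<close>, has a closed graph: if \<open>b\<^sub>n \<rightarrow> b\<close> and \<open>b\<^sub>n\<^sup>* \<rightarrow> c\<close> in \<open>B\<close>, then the
  estimate \<open>norm x\<^sup>2 \<le> norm (\<phi> x\<^sup>*) norm (\<phi> x)\<close> gives convergence in \<open>A\<close> both to \<open>b\<close> and to \<open>c\<^sup>*\<close>.  So it
  is bounded, and the same estimate now bounds \<open>\<phi>\<close> from below, which closes the graph of \<open>\<phi>\<close>.\<close>

theorem algebra_isomorphism_bounded:
  fixes \<phi> :: "'a::cstar_algebra \<Rightarrow> 'b::complex_banach_algebra"
  assumes iso: "algebra_isomorphism \<phi>"
  shows "bounded_linear \<phi>"
proof -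
  note simps = algebra_isomorphism_simps[OF iso]
  have lin: "linear \<phi>" by (rule algebra_isomorphism_linear[OF iso])
  define s where "s = inv \<phi>"
  have s: "\<phi> (s b) = b" "s (\<phi> x) = x" for b x
    using simps(4) by (simp_all add: s_def bij_def surj_f_inv_f inv_f_f)
  have s_add: "s (b + c) = s b + s c" for b c by (metis s simps(1))
  have s_scale: "s (r *\<^sub>R b) = r *\<^sub>R s b" for r b by (metis s linear_scale[OF lin])
  define T where "T b = \<phi> (cstar (s b))" for b
  have linT: "linear T"
    by (rule linearI) (simp_all add: T_def s_add s_scale cstar_simps simps linear_scale[OF lin])
  have null: "X \<longlonglongrightarrow> (0::'a)"
    if a: "(\<lambda>n. norm (\<phi> (cstar (X n)))) \<longlonglongrightarrow> k" and b: "(\<lambda>n. norm (\<phi> (X n))) \<longlonglongrightarrow> l" and kl: "k * l = 0" for X k l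
  proof -
    have "(\<lambda>n. norm (\<phi> (cstar (X n))) * norm (\<phi> (X n))) \<longlonglongrightarrow> 0"
      using tendsto_mult[OF a b] kl by simp
    then have "(\<lambda>n. (norm (X n))\<^sup>2) \<longlonglongrightarrow> 0"
      by (rule tendsto_sandwich[OF _ _ tendsto_const, rotated 2])
        (use algebra_isomorphism_norm[OF iso] in auto)
    from tendsto_real_sqrt[OF this] have "(\<lambda>n. norm (X n)) \<longlonglongrightarrow> 0" by simp
    then show ?thesis by (rule tendsto_norm_zero_cancel)
  qed
  have "bounded_linear T"
  proof (rule closed_graph[OF linT])
    fix X b c assume X: "X \<longlonglongrightarrow> b" and TX: "(\<lambda>n. T (X n)) \<longlonglongrightarrow> c"
    have A: "(\<lambda>n. s (X n) - s b) \<longlonglongrightarrow> 0"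
    proof (rule null)
      show "(\<lambda>n. norm (\<phi> (cstar (s (X n) - s b)))) \<longlonglongrightarrow> norm (c - T b)"
        using tendsto_norm[OF tendsto_diff[OF TX tendsto_const[of "T b"]]]
        by (simp add: cstar_diff linear_diff[OF lin] T_def)
      show "(\<lambda>n. norm (\<phi> (s (X n) - s b))) \<longlonglongrightarrow> 0"
        using tendsto_norm[OF tendsto_diff[OF X tendsto_const[of b]]]
        by (simp add: linear_diff[OF lin] s)
    qed simp
    have B: "(\<lambda>n. cstar (s (X n)) - s c) \<longlonglongrightarrow> 0"
    proof (rule null)
      show "(\<lambda>n. norm (\<phi> (cstar (cstar (s (X n)) - s c)))) \<longlonglongrightarrow> norm (b - T c)"
        using tendsto_norm[OF tendsto_diff[OF X tendsto_const[of "T c"]]]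
        by (simp add: cstar_diff cstar_cstar linear_diff[OF lin] s T_def)
      show "(\<lambda>n. norm (\<phi> (cstar (s (X n)) - s c))) \<longlonglongrightarrow> 0"
        using tendsto_norm[OF tendsto_diff[OF TX tendsto_const[of c]]]
        by (simp add: linear_diff[OF lin] s T_def)
    qed simp
    have "(\<lambda>n. cstar (s (X n) - s b)) \<longlonglongrightarrow> 0"
      using A by (subst tendsto_norm_zero_iff[symmetric]) (simp add: tendsto_norm_zero)
    from tendsto_diff[OF B this] have "(\<lambda>n. cstar (s b) - s c) \<longlonglongrightarrow> 0" by (simp add: cstar_diff)
    then have "cstar (s b) = s c" by (simp add: LIMSEQ_const_iff)
    then show "T b = c" by (simp add: T_def s)
  qed
  then obtain K where K: "norm (T b) \<le> norm b * K" for b by (auto dest: bounded_linear.bounded)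
  show ?thesis
  proof (rule closed_graph[OF lin])
    fix X x b assume X: "X \<longlonglongrightarrow> x" and PX: "(\<lambda>n. \<phi> (X n)) \<longlonglongrightarrow> b"
    have P0: "(\<lambda>n. norm (\<phi> (X n - s b))) \<longlonglongrightarrow> 0"
      using tendsto_norm[OF tendsto_diff[OF PX tendsto_const[of b]]]
      by (simp add: linear_diff[OF lin] s)
    have "(\<lambda>n. X n - s b) \<longlonglongrightarrow> 0"
    proof (rule null[OF _ P0])
      show "(\<lambda>n. norm (\<phi> (cstar (X n - s b)))) \<longlonglongrightarrow> 0"
      proof (rule tendsto_sandwich[OF _ _ tendsto_const])
        show "eventually (\<lambda>n. norm (\<phi> (cstar (X n - s b))) \<le> norm (\<phi> (X n - s b)) * K) sequentially"
          using K[of "\<phi> (X _ - s b)"] by (simp add: T_def s)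
        show "(\<lambda>n. norm (\<phi> (X n - s b)) * K) \<longlonglongrightarrow> 0" using tendsto_mult_left_zero[OF P0] .
      qed simp
    qed simp
    then have "X \<longlonglongrightarrow> s b" by (simp add: LIM_zero_cancel)
    with X have "x = s b" by (rule LIMSEQ_unique)
    then show "\<phi> x = b" by (simp add: s)
  qed
qed

section \<open>The characterization of isomorphisms\<close>

theorem theorem2p1:
  fixes \<phi> :: "'a::cstar_algebra \<Rightarrow> 'b::complex_banach_algebra"
  assumes "surj \<phi>"
  shows "algebra_isomorphism \<phi> \<longleftrightarrow>
    (\<forall>xs. length xs \<in> {1, 2, 3} \<longrightarrow>
       spectrum (prod_list (map \<phi> xs)) = spectrum (prod_list xs)) \<and>
    isCont \<phi> 1"
proof
  assume iso: "algebra_isomorphism \<phi>"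
  have "prod_list (map \<phi> xs) = \<phi> (prod_list xs)" for xs
    by (induction xs) (simp_all add: algebra_isomorphism_1[OF iso] algebra_isomorphism_simps(3)[OF iso])
  moreover have "isCont \<phi> 1"
    using algebra_isomorphism_bounded[OF iso] by (rule linear_continuous_at)
  ultimately show "(\<forall>xs. length xs \<in> {1, 2, 3} \<longrightarrow>
       spectrum (prod_list (map \<phi> xs)) = spectrum (prod_list xs)) \<and> isCont \<phi> 1"
    by (simp add: algebra_isomorphism_spectrum[OF iso])
next
  assume "(\<forall>xs. length xs \<in> {1, 2, 3} \<longrightarrow>
       spectrum (prod_list (map \<phi> xs)) = spectrum (prod_list xs)) \<and> isCont \<phi> 1"
  then have spec: "spectrum (prod_list (map \<phi> xs)) = spectrum (prod_list xs)"
    if "length xs \<in> {1, 2, 3}" for xs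
    using that by blast
  interpret product_spectrum_map \<phi>
  proof
    show "surj \<phi>" by fact
    show "spectrum (\<phi> x) = spectrum x" for x using spec[of "[x]"] by simp
    show "spectrum (\<phi> x * \<phi> y) = spectrum (x * y)" for x y using spec[of "[x, y]"] by simp
    show "spectrum (\<phi> x * \<phi> y * \<phi> z) = spectrum (x * y * z)" for x y z
      using spec[of "[x, y, z]"] by (simp add: mult.assoc)
  qed
  show "algebra_isomorphism \<phi>" by (rule phi_isomorphism)
qed

end
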